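(* Let each vertex $v$ of the two-dimensional integer grid $\mathbb{Z}^2$ receive an independent age $X_v$ uniform on $[0,1]$. Then with probability $1$, the subgraph of $\mathbb{Z}^2$ induced on $T_4(\mathbb{Z}^2)$ (the union of the first four layers) has a unique infinite connected component.
   Context: $\mathbb{Z}^2$ is the graph on $\mathbb{Z}^2$ where two vertices are adjacent iff they differ by $1$ in exactly one coordinate. For an infinite graph with i.i.d. $U[0,1]$ ages (a.s. distinct), the $k$-th layer $L_k$ is the set of vertices having exactly $k-1$ neighbors with smaller age, and $T_k=\bigcup_{i=1}^k L_i$. *)

theory Defs
  imports "HOL-Probability.Probability"
begin

text \<open>
  A simple graph is given by its symmetric, irreflexive adjacency relation; its vertex set is the
  whole underlying type.
\<close>

type_synonym 'v graph = "'v rel"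

definition grid2 :: "(int \<times> int) graph" where
  "grid2 = {((a, b), (c, d)). \<bar>a - c\<bar> = 1 \<and> b = d \<or> a = c \<and> \<bar>b - d\<bar> = 1}"

definition younger_nbrs :: "'v graph \<Rightarrow> ('v \<Rightarrow> real) \<Rightarrow> 'v \<Rightarrow> 'v set" where
  "younger_nbrs G age v = {u. (v, u) \<in> G \<and> age u < age v}"

text \<open>
  Writing \<open>Suc (card _) = k\<close> avoids the truncated \<open>k - 1\<close>: the layers are indexed from 1, and layer 0
  is empty. The finiteness conjunct matters only for graphs that are not locally finite, since
  \<open>card\<close> of an infinite set is 0.
\<close>

definition layer :: "'v graph \<Rightarrow> ('v \<Rightarrow> real) \<Rightarrow> nat \<Rightarrow> 'v set" where
  "layer G age k =
     {v. finite (younger_nbrs G age v) \<and> Suc (card (younger_nbrs G age v)) = k}"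

definition layers_upto :: "'v graph \<Rightarrow> ('v \<Rightarrow> real) \<Rightarrow> nat \<Rightarrow> 'v set" where
  "layers_upto G age k = (\<Union>i\<in>{1..k}. layer G age i)"

definition induced_edges :: "'v graph \<Rightarrow> 'v set \<Rightarrow> 'v rel" where
  "induced_edges G S = G \<inter> S \<times> S"

text \<open>
  The vertex sets of the connected components of the subgraph of \<open>G\<close> induced on \<open>S\<close>. The restriction
  to \<open>S \<times> S\<close> removes the reflexive pairs that \<open>\<^sup>*\<close> adds outside \<open>S\<close>.
\<close>

definition induced_components :: "'v graph \<Rightarrow> 'v set \<Rightarrow> 'v set set" where
  "induced_components G S = S // ((induced_edges G S)\<^sup>* \<inter> S \<times> S)"

end

theory Submission
  imports Defs
begin

text \<open>
  The complement of \<open>T\<^sub>4\<close> is the set \<open>D\<close> of strict local maxima of the ages, which is an independent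
  set, so its pieces can only touch diagonally.

  A diagonal path that is chordless pays, at each of its vertices, for the grid neighbours it meets
  for the first time: a factor \<open>1/3\<close> when it goes straight, with three ways to continue, and \<open>1/2\<close>
  after a turn, with two ways to continue. So the expected number of such paths in \<open>D\<close> starting at a
  vertex stays bounded as their length grows, and since consecutive maxima also share neighbours a
  further constant factor below 1 is gained for every two steps: the expectation decays
  exponentially. By Borel--Cantelli all diagonal clusters of \<open>D\<close> are finite, and those starting far
  to the right near the horizontal axis do not come back to the vertical axis.

  Two-colour the components of the complement. The diagonals of faces where both ends lie in \<open>D\<close> and
  the other two corners have different colours form an even graph, so the parity of the number of
  them to the right of a vertex is constant on components, and changes exactly where the colour
  does. Applied to the finitely many clusters meeting a box, this excludes two infinite components. If
  all components were finite, colour those that meet a long horizontal segment starting at the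
  origin: some diagonals would have to separate the origin from infinity, but those to its right
  belong to clusters that stay right of the vertical axis, which separate nothing left of them.
\<close>

section \<open>Grid and diagonal neighbours, and ray parity over sets of faces\<close>

fun nbrs :: "int \<times> int \<Rightarrow> (int \<times> int) set" where
  "nbrs (x, y) = {(x + 1, y), (x - 1, y), (x, y + 1), (x, y - 1)}"

fun diags :: "int \<times> int \<Rightarrow> (int \<times> int) set" where
  "diags (x, y) = {(x + 1, y + 1), (x - 1, y - 1), (x + 1, y - 1), (x - 1, y + 1)}"

lemma nbrs_sym: "u \<in> nbrs v \<longleftrightarrow> v \<in> nbrs u"
  by (cases u; cases v) auto

lemma grid2_iff: "(u, v) \<in> grid2 \<longleftrightarrow> v \<in> nbrs u"
  by (cases u; cases v) (auto simp: grid2_def abs_if split: if_splits)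

definition diag_links :: "(int \<times> int) set \<Rightarrow> (int \<times> int) rel" where
  "diag_links D = {(u, v). u \<in> D \<and> v \<in> D \<and> v \<in> diags u}"

text \<open>A pair in \<open>E\<close> names the unit face with that lower left corner. The ray from
  \<open>v\<close> runs to the right between the rows \<open>snd v\<close> and
  \<open>snd v + 1\<close>, so it meets faces rather than vertices: the ray-crossing test for being
  enclosed.\<close>

definition inside :: "(int \<times> int) set \<Rightarrow> int \<times> int \<Rightarrow> bool" where
  "inside E v = odd (card {x. fst v \<le> x \<and> (x, snd v) \<in> E})"

lemma in_box: "\<bar>fst a\<bar> \<le> n \<Longrightarrow> \<bar>snd a\<bar> \<le> n \<Longrightarrow> a \<in> {-n..n} \<times> {-n..n}" for n :: int
  by (simp add: mem_Times_iff abs_le_iff)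

lemma not_inside_if_row_empty: "{x'. x \<le> x' \<and> (x', y) \<in> E} = {} \<Longrightarrow> \<not> inside E (x, y)"
  by (simp only: inside_def fst_conv snd_conv card.empty even_zero not_not)

text \<open>A vertex is a corner of only four faces, so four translates of \<open>S\<close> cover
  \<open>F\<close>. This makes walls finite, either because their ends are or because the vertices
  of one colour are.\<close>

lemma finite_if_corner_finite:
  fixes F S :: "(int \<times> int) set"
  assumes "finite S"
    and "\<And>x y. (x, y) \<in> F \<Longrightarrow> (x, y) \<in> S \<or> (x + 1, y) \<in> S \<or> (x, y + 1) \<in> S \<or> (x + 1, y + 1) \<in> S"
  shows "finite F"
proof (rule finite_subset)
  let ?U = "S \<union> (\<lambda>v. (fst v - 1, snd v)) ` S \<union> (\<lambda>v. (fst v, snd v - 1)) ` S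
    \<union> (\<lambda>v. (fst v - 1, snd v - 1)) ` S"
  show "F \<subseteq> ?U"
  proof
    fix v assume v: "v \<in> F"
    have "v = (\<lambda>v. (fst v - 1, snd v)) (fst v + 1, snd v)"
      "v = (\<lambda>v. (fst v, snd v - 1)) (fst v, snd v + 1)"
      "v = (\<lambda>v. (fst v - 1, snd v - 1)) (fst v + 1, snd v + 1)" by simp_all
    moreover have "v \<in> S \<or> (fst v + 1, snd v) \<in> S \<or> (fst v, snd v + 1) \<in> S \<or> (fst v + 1, snd v + 1) \<in> S"
      using assms(2)[of "fst v" "snd v"] v by simp
    ultimately show "v \<in> ?U" by blast
  qed
qed (use assms in simp)

section \<open>Walls between two colours\<close>

locale walled =
  fixes D V :: "(int \<times> int) set" and A :: "int \<times> int \<Rightarrow> bool"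
  assumes indep: "\<And>u v. u \<in> D \<Longrightarrow> v \<in> nbrs u \<Longrightarrow> v \<notin> D"
    and label: "\<And>u v. u \<notin> D \<Longrightarrow> v \<notin> D \<Longrightarrow> v \<in> nbrs u \<Longrightarrow> A u = A v"
    and V_sub: "V \<subseteq> D"
    and V_closed: "\<And>u v. u \<in> V \<Longrightarrow> v \<in> D \<Longrightarrow> v \<in> diags u \<Longrightarrow> v \<in> V"
begin

text \<open>A wall is a face diagonal, indexed by the lower left corner of its face:
  \<open>wall1\<close> rises and \<open>wall2\<close> falls. Walls are restricted to a union
  \<open>V\<close> of diagonal clusters of \<open>D\<close>, so that finitely many clusters, or only
  those right of the vertical axis, can be studied alone.\<close>

definition wall1 :: "int \<Rightarrow> int \<Rightarrow> bool" where
  "wall1 x y \<longleftrightarrow> (x, y) \<in> V \<and> (x + 1, y + 1) \<in> V \<and> A (x + 1, y) \<noteq> A (x, y + 1)"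

definition wall2 :: "int \<Rightarrow> int \<Rightarrow> bool" where
  "wall2 x y \<longleftrightarrow> (x + 1, y) \<in> V \<and> (x, y + 1) \<in> V \<and> A (x, y) \<noteq> A (x + 1, y + 1)"

definition walls :: "(int \<times> int) set" where
  "walls = {(x, y). wall1 x y \<or> wall2 x y}"

lemma not_both: "\<not> (wall1 x y \<and> wall2 x y)"
  using indep[of "(x, y)" "(x + 1, y)"] V_sub by (auto simp: wall1_def wall2_def)

text \<open>If the far end of a diagonal at a vertex of \<open>V\<close> is not in \<open>V\<close>,
  then closure puts it outside \<open>D\<close>, so it joins the other two corners of the face and
  their colours agree. Hence the colours alone decide whether there is a wall.\<close>

lemma
  assumes "(x, y) \<in> V"
  shows wall1_up: "wall1 x y \<longleftrightarrow> A (x + 1, y) \<noteq> A (x, y + 1)"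
    and wall1_down: "wall1 (x - 1) (y - 1) \<longleftrightarrow> A (x, y - 1) \<noteq> A (x - 1, y)"
    and wall2_up: "wall2 (x - 1) y \<longleftrightarrow> A (x - 1, y) \<noteq> A (x, y + 1)"
    and wall2_down: "wall2 x (y - 1) \<longleftrightarrow> A (x, y - 1) \<noteq> A (x + 1, y)"
proof -
  have n: "(x + 1, y) \<notin> D" "(x - 1, y) \<notin> D" "(x, y + 1) \<notin> D" "(x, y - 1) \<notin> D"
    using assms indep[of "(x, y)"] V_sub by auto
  have c: "A u = A w" if "u \<notin> D" "w \<notin> D" "v \<in> diags (x, y)" "v \<notin> V" "u \<in> nbrs v" "w \<in> nbrs v" for u v w
  proof -
    have "v \<notin> D" using V_closed assms that by blast
    then show ?thesis using label that by metis
  qed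
  show "wall1 x y \<longleftrightarrow> A (x + 1, y) \<noteq> A (x, y + 1)"
    using assms n c[of "(x + 1, y)" "(x, y + 1)" "(x + 1, y + 1)"] by (auto simp: wall1_def)
  show "wall1 (x - 1) (y - 1) \<longleftrightarrow> A (x, y - 1) \<noteq> A (x - 1, y)"
    using assms n c[of "(x - 1, y)" "(x, y - 1)" "(x - 1, y - 1)"] by (auto simp: wall1_def)
  show "wall2 (x - 1) y \<longleftrightarrow> A (x - 1, y) \<noteq> A (x, y + 1)"
    using assms n c[of "(x - 1, y)" "(x, y + 1)" "(x - 1, y + 1)"] by (auto simp: wall2_def)
  show "wall2 x (y - 1) \<longleftrightarrow> A (x, y - 1) \<noteq> A (x + 1, y)"
    using assms n c[of "(x + 1, y)" "(x, y - 1)" "(x + 1, y - 1)"] by (auto simp: wall2_def)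
qed

text \<open>Around a vertex of \<open>V\<close> the four possible walls are the colour changes
  between cyclically consecutive grid neighbours, and these cancel.\<close>

lemma even_degree:
  "((wall1 x y \<noteq> wall1 (x - 1) (y - 1)) \<noteq> (wall2 (x - 1) y \<noteq> wall2 x (y - 1))) = False"
proof (cases "(x, y) \<in> V")
  case True
  then show ?thesis
    by (auto simp: wall1_up wall1_down wall2_up wall2_down)
next
  case False
  then show ?thesis by (simp add: wall1_def wall2_def)
qed

end

section \<open>Vertices enclosed by finitely many walls\<close>

locale finite_walls = walled +
  assumes fin: "finite walls"
begin

lemma finite_row: "finite {x. a \<le> x \<and> (x, y) \<in> walls}"
  by (rule finite_surj[OF fin, of _ fst]) force

lemma inside_step:
  "inside walls (x, y) \<longleftrightarrow> inside walls (x + 1, y) \<noteq> ((x, y) \<in> walls)"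
proof -
  have "{x'. x \<le> x' \<and> (x', y) \<in> walls} =
      (if (x, y) \<in> walls then {x} else {}) \<union> {x'. x + 1 \<le> x' \<and> (x', y) \<in> walls}"
    by (auto dest: order_antisym)
  moreover have "x \<notin> {x'. x + 1 \<le> x' \<and> (x', y) \<in> walls}" by simp
  ultimately show ?thesis
    using finite_row[of "x + 1" y] by (auto simp: inside_def)
qed

lemma walls_bounded: "\<exists>B. \<forall>v\<in>walls. - B \<le> fst v \<and> fst v < B \<and> snd v < B"
proof -
  have "finite ((\<lambda>v. \<bar>fst v\<bar> + \<bar>snd v\<bar>) ` walls)" using fin by simp
  from bdd_above_finite[OF this] obtain B where B: "\<And>v. v \<in> walls \<Longrightarrow> \<bar>fst v\<bar> + \<bar>snd v\<bar> \<le> B"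
    unfolding bdd_above_def by blast
  have "- (B + 1) \<le> fst v \<and> fst v < B + 1 \<and> snd v < B + 1" if "v \<in> walls" for v
    using B[OF that] by linarith
  then show ?thesis by blast
qed

lemma inside_right: "\<exists>X. \<forall>x\<ge>X. \<forall>y. \<not> inside walls (x, y) \<and> \<not> wall1 x y \<and> \<not> wall2 x y"
proof -
  obtain B where B: "\<forall>v\<in>walls. fst v < B"
    using walls_bounded by blast
  have "{x'. x \<le> x' \<and> (x', y) \<in> walls} = {}" if "x \<ge> B" for x y
    using B that by fastforce
  moreover have "\<not> wall1 x y \<and> \<not> wall2 x y" if "x \<ge> B" for x y
    using B that by (fastforce simp: walls_def)
  ultimately show ?thesis by (intro exI[of _ B] allI impI conjI not_inside_if_row_empty) auto
qed

text \<open>Each wall met by the two rays has one end in row \<open>y\<close>. Adding up the even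
  degrees of the vertices of that row strictly right of \<open>x\<close> cancels all of them but the
  two walls that leave \<open>(x, y)\<close> to the right. The induction does this starting from the
  far right.\<close>

lemma inside_rows:
  "(inside walls (x, y - 1) \<noteq> inside walls (x, y)) \<longleftrightarrow> (wall2 x (y - 1) \<noteq> wall1 x y)"
proof -
  obtain X where X: "\<And>x y. x \<ge> X \<Longrightarrow> \<not> inside walls (x, y) \<and> \<not> wall1 x y \<and> \<not> wall2 x y"
    using inside_right by blast
  show ?thesis
  proof (cases "x \<ge> X")
    case True
    then show ?thesis using X by blast
  next
    case False
    then have "x \<le> X" by simp
    then show ?thesis
    proof (induction x rule: int_le_induct)
      case base
      then show ?case using X by blast
    next
      case (step i)
      have "inside walls (i - 1, z) \<longleftrightarrow> inside walls (i, z) \<noteq> (wall1 (i - 1) z \<noteq> wall2 (i - 1) z)" for z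
        using inside_step[of "i - 1" z] not_both[of "i - 1" z] by (auto simp: walls_def)
      then show ?case using step.IH even_degree[of i y] by auto
    qed
  qed
qed

text \<open>The column of faces at \<open>x - 1\<close> has no wall, so the parity is the same in
  all rows along column \<open>x\<close>, and above all walls it is even.\<close>

lemma not_inside_left: 
  assumes "\<And>v. v \<in> walls \<Longrightarrow> x \<le> fst v"
  shows "\<not> inside walls (x, y)"
proof -
  have "wall2 (x - 1) z = False \<and> wall1 (x - 1) z = False \<and> ((x - 1, z) \<in> walls) = False" for z
    using assms[of "(x - 1, z)"] by (auto simp: walls_def)
  then have same: "inside walls (x, z - 1) = inside walls (x, z)" for z
    using inside_rows[of "x - 1" z] inside_step[of "x - 1"] by simp
  obtain B where B: "\<forall>v\<in>walls. snd v < B"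
    using walls_bounded by blast
  have far: "\<not> inside walls (x, z)" if "z \<ge> B" for z
  proof -
    have "{x'. x \<le> x' \<and> (x', z) \<in> walls} = {}" using B that by fastforce
    then show ?thesis by (rule not_inside_if_row_empty)
  qed
  show ?thesis
  proof (cases "y \<ge> B")
    case False
    then have "y \<le> B" by simp
    then show ?thesis
      by (induction y rule: int_le_induct) (use far same in auto)
  qed (rule far)
qed

text \<open>An enclosed vertex has a wall to its right in its own row of faces, and by
  \<open>not_inside_left\<close> it cannot lie left of all walls.\<close>

lemma finite_inside: "finite {v. inside walls v}"
proof -
  obtain a b where ab: "\<forall>v\<in>walls. a \<le> fst v \<and> fst v \<le> b"
    using walls_bounded by (meson less_imp_le)
  have "{v. inside walls v} \<subseteq> {a..b} \<times> snd ` walls"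
  proof
    fix v assume "v \<in> {v. inside walls v}"
    then obtain x y where v: "v = (x, y)" "inside walls (x, y)" by (cases v) auto
    have "{x'. x \<le> x' \<and> (x', y) \<in> walls} \<noteq> {}"
      using v(2) not_inside_if_row_empty by blast
    then obtain x' where x': "x \<le> x'" "(x', y) \<in> walls" by auto
    have "a \<le> x"
    proof (rule ccontr)
      assume "\<not> a \<le> x"
      then have "\<And>v. v \<in> walls \<Longrightarrow> x \<le> fst v" using ab by fastforce
      then show False using not_inside_left v by blast
    qed
    then show "v \<in> {a..b} \<times> snd ` walls"
      using x' ab v by force
  qed
  then show ?thesis by (rule finite_subset) (use fin in auto)
qed

text \<open>Comparing two neighbours brings in only walls that end at one of the two.\<close>

lemma inside_edge:
  assumes "u \<notin> V" "v \<notin> V" "v \<in> nbrs u"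
  shows "inside walls u = inside walls v"
proof -
  have h: "inside walls (x, y) = inside walls (x + 1, y)" if "(x, y) \<notin> V" "(x + 1, y) \<notin> V" for x y
    using inside_step[of x y] that by (auto simp: walls_def wall1_def wall2_def)
  have k: "inside walls (x, y - 1) = inside walls (x, y)" if "(x, y) \<notin> V" for x y
    using inside_rows[of x y] that by (auto simp: wall1_def wall2_def)
  obtain x y where u: "u = (x, y)" by (cases u)
  show ?thesis
    using assms h[of x y] h[of "x - 1" y] k[of x y] k[of x "y + 1"] by (auto simp: u)
qed

text \<open>The label and the parity change together at every wall, so their sum sees no wall.\<close>

definition lsum :: "int \<times> int \<Rightarrow> bool" where
  "lsum v \<longleftrightarrow> A v \<noteq> inside walls v"

lemma lsum_edge:
  assumes "u \<notin> D" "v \<notin> D" "v \<in> nbrs u"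
  shows "lsum u = lsum v"
  using inside_edge[of u v] label[of u v] assms V_sub by (auto simp: lsum_def)

text \<open>Going round a vertex of \<open>V\<close>, one crosses its four diagonals; the colour
  changes at a crossing exactly when there is a wall, that is, when the parity changes.\<close>

lemma lsum_around:
  assumes "v \<in> V" "u \<in> nbrs v" "w \<in> nbrs v"
  shows "lsum u = lsum w"
proof -
  obtain x y where v: "v = (x, y)" by (cases v)
  have n: "(x + 1, y) \<notin> V" "(x - 1, y) \<notin> V" "(x, y + 1) \<notin> V" "(x, y - 1) \<notin> V"
    using assms indep[of "(x, y)"] V_sub v by auto
  have V: "(x, y) \<in> V" using assms v by simp
  \<comment> \<open>The other diagonal of each of these faces would end at a grid neighbour of
    \<open>(x, y)\<close>.\<close>
  have "(x, y) \<in> walls \<longleftrightarrow> wall1 x y" "(x - 1, y) \<in> walls \<longleftrightarrow> wall2 (x - 1) y"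
    using n by (auto simp: walls_def wall1_def wall2_def)
  then have R: "inside walls (x, y) \<longleftrightarrow> inside walls (x + 1, y) \<noteq> wall1 x y"
      "inside walls (x - 1, y) \<longleftrightarrow> inside walls (x, y) \<noteq> wall2 (x - 1) y"
    using inside_step[of x y] inside_step[of "x - 1" y] by auto
  have U: "inside walls (x, y) = inside walls (x, y + 1)"
    using inside_rows[of x "y + 1"] n by (auto simp: wall1_def wall2_def)
  have L: "lsum (x + 1, y) = lsum (x, y + 1)" "lsum (x - 1, y) = lsum (x, y + 1)"
      "lsum (x, y - 1) = lsum (x + 1, y)"
    using R U inside_rows[of x y] wall1_up[OF V] wall2_up[OF V] wall2_down[OF V]
    by (auto simp: lsum_def)
  show ?thesis using assms(2,3) L by (auto simp: v)
qed

lemma lsum_box: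
  assumes box: "D \<inter> ({-n..n} \<times> {-n..n}) \<subseteq> V"
    and u: "u \<in> {-n..n} \<times> {-n..n}" "u \<notin> D" and v: "v \<in> {-n..n} \<times> {-n..n}" "v \<notin> D"
  shows "lsum u = lsum v"
proof -
  \<comment> \<open>A vertex of \<open>D\<close> is given the sum of its right neighbour, which may
    lie outside the box; by \<open>lsum_around\<close> any neighbour could stand in. This makes
    \<open>h\<close> constant along all edges of the box.\<close>
  define h where "h w = (if w \<in> D then lsum (fst w + 1, snd w) else lsum w)" for w
  have r: "(fst w + 1, snd w) \<in> nbrs w" for w :: "int \<times> int" by (cases w) simp
  have one: "h a = h b" if "a \<in> {-n..n} \<times> {-n..n}" "b \<in> nbrs a" "a \<in> D" for a b
  proof -
    have "b \<notin> D" using indep that by blast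
    moreover have "a \<in> V" using box that by blast
    ultimately show ?thesis
      using lsum_around[of a "(fst a + 1, snd a)" b] that r[of a] by (simp add: h_def)
  qed
  have nb: "h a = h b" if "a \<in> {-n..n} \<times> {-n..n}" "b \<in> {-n..n} \<times> {-n..n}" "b \<in> nbrs a" for a b
  proof (cases "a \<in> D \<or> b \<in> D")
    case True
    then show ?thesis using one[of a b] one[of b a] that nbrs_sym by metis
  next
    case False
    then show ?thesis using lsum_edge[of a b] that by (simp add: h_def)
  qed
  have row: "h (x, y) = h (-n, y)" if "-n \<le> x" "x \<le> n" "-n \<le> y" "y \<le> n" for x y
    using that(1,2)
  proof (induction x rule: int_ge_induct)
    case (step i)
    then show ?case using step.IH step.prems that nb[of "(i, y)" "(i + 1, y)"] by simp
  qed simp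
  have col: "h (-n, y) = h (-n, -n)" if "-n \<le> y" "y \<le> n" for y
    using that
  proof (induction y rule: int_ge_induct)
    case (step i)
    then show ?case using step.IH step.prems nb[of "(-n, i)" "(-n, i + 1)"] by simp
  qed simp
  have "h w = h (-n, -n)" if "w \<in> {-n..n} \<times> {-n..n}" for w
  proof -
    have w: "-n \<le> fst w" "fst w \<le> n" "-n \<le> snd w" "snd w \<le> n"
      using that by (auto simp: mem_Times_iff)
    have "h (fst w, snd w) = h (-n, snd w)" by (rule row[OF w])
    moreover have "h (-n, snd w) = h (-n, -n)" by (rule col[OF w(3,4)])
    ultimately have "h (fst w, snd w) = h (-n, -n)" by (rule trans)
    then show ?thesis by simp
  qed
  from trans[OF this[OF u(1)] this[OF v(1), symmetric]] have "h u = h v" .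
  then show ?thesis using u v by (simp add: h_def)
qed

end

section \<open>Infinite components of the complement of an independent set\<close>

lemma induced_components_iff:
  "C \<in> induced_components G S \<longleftrightarrow> (\<exists>a\<in>S. C = (induced_edges G S)\<^sup>* `` {a})"
proof -
  have "b \<in> S" if "(a, b) \<in> (induced_edges G S)\<^sup>*" "a \<in> S" for a b
    using that by (induction rule: rtrancl_induct) (auto simp: induced_edges_def)
  then have "((induced_edges G S)\<^sup>* \<inter> S \<times> S) `` {a} = (induced_edges G S)\<^sup>* `` {a}" if "a \<in> S" for a
    using that by auto
  then show ?thesis by (auto simp: induced_components_def quotient_def)
qed

lemma induced_edges_grid2_sym: "sym (induced_edges grid2 S)"
  using nbrs_sym by (auto simp: sym_def induced_edges_def grid2_iff)

locale indep_grid_set =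
  fixes D :: "(int \<times> int) set"
  assumes indep: "\<And>u v. u \<in> D \<Longrightarrow> v \<in> nbrs u \<Longrightarrow> v \<notin> D"
begin

definition conn where "conn = (induced_edges grid2 (- D))\<^sup>*"

lemma conn_edge: "u \<notin> D \<Longrightarrow> v \<notin> D \<Longrightarrow> v \<in> nbrs u \<Longrightarrow> (u, v) \<in> conn"
  by (auto simp: conn_def induced_edges_def grid2_iff)

lemma conn_sym: "(u, v) \<in> conn \<Longrightarrow> (v, u) \<in> conn"
  using sym_rtrancl[OF induced_edges_grid2_sym] unfolding conn_def by (rule symD)

lemma conn_trans: "(u, v) \<in> conn \<Longrightarrow> (v, w) \<in> conn \<Longrightarrow> (u, w) \<in> conn"
  unfolding conn_def by (rule rtrancl_trans)

lemma conn_refl: "(u, u) \<in> conn"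
  by (simp add: conn_def)

lemma conn_const:
  assumes "(a, b) \<in> conn" and "\<And>u v. u \<notin> D \<Longrightarrow> v \<notin> D \<Longrightarrow> v \<in> nbrs u \<Longrightarrow> f u = f v"
  shows "f a = f b"
  using assms(1) unfolding conn_def
  by (induction rule: rtrancl_induct) (use assms(2) in \<open>auto simp: induced_edges_def grid2_iff\<close>)

lemma component_iff:
  "C \<in> induced_components grid2 (- D) \<longleftrightarrow> (\<exists>a. a \<notin> D \<and> C = conn `` {a})"
  by (auto simp: induced_components_iff conn_def)

text \<open>Colour the component of \<open>a\<close>. The parity is constant on components and only
  finitely many vertices are enclosed, so neither infinite component is. Equal sums at
  \<open>a\<close> and \<open>b\<close> then mean equal colours.\<close>

lemma infinite_component_unique:
  assumes clusters: "\<And>v. finite ((diag_links D)\<^sup>* `` {v})"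
    and that: "a \<notin> D" "b \<notin> D"
    and inf: "infinite (conn `` {a})" "infinite (conn `` {b})"
  shows "conn `` {a} = conn `` {b}"
proof (rule ccontr)
  assume ne: "conn `` {a} \<noteq> conn `` {b}"
  then have ab: "(a, b) \<notin> conn" using conn_sym conn_trans by blast
  define n where "n = \<bar>fst a\<bar> + \<bar>snd a\<bar> + \<bar>fst b\<bar> + \<bar>snd b\<bar>"
  have n: "a \<in> {-n..n} \<times> {-n..n}" "b \<in> {-n..n} \<times> {-n..n}"
    unfolding n_def by (intro in_box; linarith)+
  \<comment> \<open>The clusters that meet the box: finitely many finite sets, yet they contain all
    of \<open>D\<close> in the box, as \<open>lsum_box\<close> requires.\<close>
  define V where "V = D \<inter> (\<Union>v\<in>{-n..n} \<times> {-n..n}. (diag_links D)\<^sup>* `` {v})"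
  interpret w: walled D V "\<lambda>v. (a, v) \<in> conn"
  proof
    show "v \<in> V" if "u \<in> V" "v \<in> D" "v \<in> diags u" for u v
    proof -
      have "(u, v) \<in> diag_links D" using that by (auto simp: V_def diag_links_def)
      then show ?thesis using that by (auto simp: V_def intro: rtrancl_into_rtrancl)
    qed
    show "((a, u) \<in> conn) = ((a, v) \<in> conn)" if "u \<notin> D" "v \<notin> D" "v \<in> nbrs u" for u v
      using conn_edge[OF that] conn_sym conn_trans by blast
  qed (use indep in \<open>auto simp: V_def\<close>)
  have "finite V" using clusters by (auto simp: V_def)
  then have "finite w.walls"
    by (rule finite_if_corner_finite) (auto simp: w.walls_def w.wall1_def w.wall2_def)
  then interpret w: finite_walls D V "\<lambda>v. (a, v) \<in> conn" by unfold_locales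
  have out: "\<not> inside w.walls c" if "infinite (conn `` {c})" for c
  proof
    assume c: "inside w.walls c"
    have "inside w.walls v" if "(c, v) \<in> conn" for v
      using conn_const[OF that, of "inside w.walls"] w.inside_edge c w.V_sub by blast
    then have "conn `` {c} \<subseteq> {v. inside w.walls v}" by auto
    then show False using w.finite_inside that finite_subset by blast
  qed
  have "w.lsum a = w.lsum b"
    by (rule w.lsum_box) (use n that in \<open>auto simp: V_def\<close>)
  then show False
    using ab out[OF inf(1)] out[OF inf(2)] conn_refl by (simp add: w.lsum_def)
qed

text \<open>If all components were finite, only finitely many vertices would be coloured and the sum
  would vanish outside \<open>D\<close>. A coloured vertex at the start of the ray would then be
  enclosed, but the walls met by its ray come from clusters right of the axis, which do not enclose
  it.\<close>

lemma infinite_component_exists: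
  assumes right: "\<And>c y w. N < c \<Longrightarrow> y \<in> {0, 1} \<Longrightarrow> ((c, y), w) \<in> (diag_links D)\<^sup>* \<Longrightarrow> 0 < fst w"
  shows "\<exists>a. a \<notin> D \<and> infinite (conn `` {a})"
proof (rule ccontr)
  assume "\<not> ?thesis"
  then have fin: "finite (conn `` {a})" if "a \<notin> D" for a using that by blast
  \<comment> \<open>Both rows and the extra column are there to hold all corners of the faces
    \<open>(x, 0)\<close> for \<open>x\<close> from 0 to the absolute value of \<open>N\<close>, the
    part of the ray that \<open>right\<close> does not control.\<close>
  define P where "P = {0..\<bar>N\<bar> + 1} \<times> {0, 1} - D"
  define A where "A v \<longleftrightarrow> (\<exists>p\<in>P. (p, v) \<in> conn)" for v
  have "{v. A v} = (\<Union>p\<in>P. conn `` {p})" by (auto simp: A_def)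
  moreover have "finite P" by (simp add: P_def)
  moreover have "finite (conn `` {p})" if "p \<in> P" for p using fin that by (simp add: P_def)
  ultimately have finA: "finite {v. A v}" by simp
  have A_P: "A v" if "v \<in> P" for v using that by (auto simp: A_def conn_def)
  have A_edge: "A u = A v" if "u \<notin> D" "v \<notin> D" "v \<in> nbrs u" for u v
    unfolding A_def using conn_edge[OF that] conn_sym conn_trans by blast
  \<comment> \<open>Two families of walls are compared: those of all of \<open>D\<close>, for which
    the sum is constant on the whole grid, and those of this \<open>V\<close>, which stay right of
    the axis.\<close>
  define V where "V = {v \<in> D. \<forall>w. (v, w) \<in> (diag_links D)\<^sup>* \<longrightarrow> 0 < fst w}"
  interpret w: walled D D A
    using indep A_edge by unfold_locales auto
  interpret w': walled D V A
  proof
    show "v \<in> V" if "u \<in> V" "v \<in> D" "v \<in> diags u" for u v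
    proof -
      have "(u, v) \<in> diag_links D" using that by (auto simp: V_def diag_links_def)
      then show ?thesis using that by (auto simp: V_def intro: converse_rtrancl_into_rtrancl)
    qed
  qed (use indep A_edge in \<open>auto simp: V_def\<close>)
  let ?A = "{v. A v}"
  have fw: "finite w.walls"
    by (rule finite_if_corner_finite[OF finA]) (auto simp: w.walls_def w.wall1_def w.wall2_def)
  have sub: "w'.walls \<subseteq> w.walls"
    using w'.V_sub
    by (auto simp: w.walls_def w'.walls_def w.wall1_def w'.wall1_def w.wall2_def w'.wall2_def)
  with fw have "finite w'.walls" using finite_subset by blast
  then interpret w': finite_walls D V A by unfold_locales
  interpret w: finite_walls D D A using fw by unfold_locales
  have const: "w.lsum u = w.lsum v" if "u \<notin> D" "v \<notin> D" for u v
  proof (rule w.lsum_box)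
    let ?n = "\<bar>fst u\<bar> + \<bar>snd u\<bar> + \<bar>fst v\<bar> + \<bar>snd v\<bar>"
    show "u \<in> {-?n..?n} \<times> {-?n..?n}" "v \<in> {-?n..?n} \<times> {-?n..?n}"
      by (intro in_box; linarith)+
  qed (use that in auto)
  have zero: "\<not> w.lsum v" if "v \<notin> D" for v
  proof -
    have inf: "infinite (UNIV :: (int \<times> int) set)" by (simp add: finite_prod)
    let ?F = "?A \<union> {v. inside w.walls v}"
    \<comment> \<open>Adding the left shift of \<open>?F\<close> yields two horizontal neighbours
      that are both uncoloured and not enclosed; independence leaves one of them outside
      \<open>D\<close>.\<close>
    have "finite (?F \<union> (\<lambda>(x, y). (x - 1, y)) ` ?F)" using finA w.finite_inside by simp
    from ex_new_if_finite[OF inf this]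
    obtain u where u: "u \<notin> ?F \<union> (\<lambda>(x, y). (x - 1, y)) ` ?F" ..
    obtain x y where xy: "u = (x, y)" by (cases u)
    have "(x, y) \<notin> ?F" "(x + 1, y) \<notin> ?F"
      using u image_eqI[of "(x, y)" "\<lambda>(x, y). (x - 1, y)" "(x + 1, y)" ?F] unfolding xy by (simp_all, blast)
    then have no: "\<not> w.lsum (x, y)" "\<not> w.lsum (x + 1, y)"
      by (auto simp: w.lsum_def)
    have "(x, y) \<notin> D \<or> (x + 1, y) \<notin> D" using indep[of "(x, y)" "(x + 1, y)"] by auto
    then show ?thesis
      using const[OF that, of "(x, y)"] const[OF that, of "(x + 1, y)"] no by argo
  qed
  have nowall: "\<not> w.wall1 x 0" "\<not> w.wall2 x 0" if "0 \<le> x" "x \<le> \<bar>N\<bar>" for x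
  proof -
    have P: "A (z, y)" if "z \<in> {x, x + 1}" "y \<in> {0, 1}" "(z, y) \<notin> D" for z y
      by (rule A_P) (use that \<open>0 \<le> x\<close> \<open>x \<le> \<bar>N\<bar>\<close> in \<open>auto simp: P_def\<close>)
    show "\<not> w.wall1 x 0"
      using P[of "x + 1" 0] P[of x 1] indep[of "(x, 0)" "(x + 1, 0)"] indep[of "(x, 0)" "(x, 1)"]
      by (auto simp: w.wall1_def)
    show "\<not> w.wall2 x 0"
      using P[of x 0] P[of "x + 1" 1] indep[of "(x + 1, 0)" "(x, 0)"] indep[of "(x + 1, 0)" "(x + 1, 1)"]
      by (auto simp: w.wall2_def)
  qed
  have nowall': "((x, 0) \<in> w.walls) = ((x, 0) \<in> w'.walls)" if "0 \<le> x" for x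
  proof (cases "x \<le> \<bar>N\<bar>")
    case True
    then show ?thesis using nowall[OF that True] sub by (auto simp: w.walls_def)
  next
    case False
    then have V: "(z, y) \<in> V \<longleftrightarrow> (z, y) \<in> D" if "x \<le> z" "y \<in> {0, 1}" for z y
      using right[of z y] that by (auto simp: V_def)
    show ?thesis
      using V[of x 0] V[of "x + 1" 0] V[of x 1] V[of "x + 1" 1]
      by (simp add: w.walls_def w'.walls_def w.wall1_def w'.wall1_def w.wall2_def w'.wall2_def)
  qed
  have "inside w.walls (0, 0) = inside w'.walls (0, 0)"
  proof -
    have "{x. 0 \<le> x \<and> (x, 0) \<in> w.walls} = {x. 0 \<le> x \<and> (x, 0) \<in> w'.walls}" using nowall' by blast
    then show ?thesis by (simp only: inside_def fst_conv snd_conv)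
  qed
  moreover have "\<not> inside w'.walls (0, 0)"
  proof (rule w'.not_inside_left)
    fix v assume "v \<in> w'.walls"
    then have v: "(fst v, snd v) \<in> V \<or> (fst v, snd v + 1) \<in> V"
      by (cases v) (auto simp: w'.walls_def w'.wall1_def w'.wall2_def)
    have "0 < fst u" if "u \<in> V" for u using that rtrancl_refl unfolding V_def by blast
    from this[of "(fst v, snd v)"] this[of "(fst v, snd v + 1)"] v show "0 \<le> fst v" by auto
  qed
  ultimately have n0: "\<not> inside w.walls (0, 0)" by simp
  \<comment> \<open>In case the origin is in \<open>D\<close>, its right neighbour takes its place;
    the face \<open>(0, 0)\<close> has no wall, so the parity is the same.\<close>
  have n1: "\<not> inside w.walls (1, 0)"
    using n0 w.inside_step[of 0 0] nowall[of 0] by (auto simp: w.walls_def)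
  show False
  proof (cases "(0, 0) \<in> D")
    case False
    then show ?thesis using zero[OF False] n0 A_P[of "(0, 0)"] by (auto simp: w.lsum_def P_def)
  next
    case True
    then have "(1, 0) \<notin> D" using indep[of "(0, 0)"] by auto
    then show ?thesis using zero[of "(1, 0)"] n1 A_P[of "(1, 0)"] by (auto simp: w.lsum_def P_def)
  qed
qed

end

theorem unique_infinite_component_if_finite_clusters:
  fixes D :: "(int \<times> int) set"
  assumes "\<And>u v. u \<in> D \<Longrightarrow> v \<in> nbrs u \<Longrightarrow> v \<notin> D"
    and clusters: "\<And>v. finite ((diag_links D)\<^sup>* `` {v})"
    and right: "\<And>c y w. N < c \<Longrightarrow> y \<in> {0, 1} \<Longrightarrow> ((c, y), w) \<in> (diag_links D)\<^sup>* \<Longrightarrow> 0 < fst w"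
  shows "\<exists>!C. C \<in> induced_components grid2 (- D) \<and> infinite C"
proof -
  interpret indep_grid_set D using assms(1) by unfold_locales
  show ?thesis
    using infinite_component_unique[OF clusters] infinite_component_exists[of N] right
    unfolding component_iff by blast
qed

section \<open>Independent uniform ages and probabilities of being a maximum\<close>

definition decay :: real where
  "decay = 1 - (1/4)^6"

lemma decay_nonneg [simp]: "0 \<le> decay" and decay_less_1: "decay < 1"
  by (simp_all add: decay_def eval_nat_numeral)

lemma pred_less_components:
  fixes N :: "'i \<Rightarrow> real measure"
  assumes "finite F" "F \<subseteq> I" "a \<in> I" and N: "\<And>i. i \<in> I \<Longrightarrow> sets (N i) = sets borel"
  shows "Measurable.pred (PiM I N) (\<lambda>x. \<forall>f\<in>F. x f < x a)"
proof -
  have "(\<lambda>x. x i) \<in> borel_measurable (PiM I N)" if "i \<in> I" for i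
    using measurable_component_singleton[OF that, of N] measurable_cong_sets[OF refl N[OF that]] by blast
  then have "Measurable.pred (PiM I N) (\<lambda>x. x f < x a)" if "f \<in> F" for f
    using assms that by (auto intro!: borel_measurable_less simp: pred_def subset_iff)
  then show ?thesis using assms(1) by (intro pred_intros_finite)
qed

locale iid_ages = prob_space M for M :: "'a measure" +
  fixes X :: "'i \<Rightarrow> 'a \<Rightarrow> real"
  assumes indep_ages: "indep_vars (\<lambda>_. borel) X UNIV"
    and age_distr: "\<And>v. distr M borel (X v) = uniform_measure lborel {0..1}"
begin

lemma age_measurable [measurable]: "X v \<in> borel_measurable M"
  using indep_ages by (simp add: indep_vars_def)

lemma prob_age_interval:
  assumes "0 \<le> a" "a \<le> b" "b \<le> 1"
  shows "\<P>(\<omega> in M. a < X v \<omega> \<and> X v \<omega> < b) = b - a"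
proof -
  have "\<P>(\<omega> in M. a < X v \<omega> \<and> X v \<omega> < b) = measure (distr M borel (X v)) {a<..<b}"
    by (subst measure_distr) (auto intro!: arg_cong[where f = "measure M"])
  also have "\<dots> = b - a"
  proof -
    have "{0..1} \<inter> {a<..<b} = {a<..<b}" using assms by auto
    then show ?thesis using assms by (simp add: age_distr)
  qed
  finally show ?thesis .
qed

text \<open>Independence of the ages passes to families over disjoint blocks; \<open>local\<close>
  expresses that \<open>Q j\<close> reads only the ages of its own block.\<close>

lemma prob_blocks:
  assumes L: "finite L" and J: "disjoint_family_on J L"
    and Q: "\<And>j. j \<in> L \<Longrightarrow> Measurable.pred (PiM (J j) (\<lambda>_. borel)) (Q j)"
    and local: "\<And>j x. j \<in> L \<Longrightarrow> Q j (restrict x (J j)) = Q j x"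
  shows "\<P>(\<omega> in M. \<forall>j\<in>L. Q j (\<lambda>v. X v \<omega>)) = (\<Prod>j\<in>L. \<P>(\<omega> in M. Q j (\<lambda>v. X v \<omega>)))"
proof (cases "L = {}")
  case True
  then show ?thesis by (simp add: prob_space)
next
  case False
  have "indep_vars (\<lambda>j. PiM (J j) (\<lambda>_. borel)) (\<lambda>j \<omega>. restrict (\<lambda>i. X i \<omega>) (J j)) L"
    by (rule indep_vars_restrict[OF indep_ages _ J]) simp
  then have "indep_events (\<lambda>j. {\<omega> \<in> space M. Q j (restrict (\<lambda>i. X i \<omega>) (J j))}) L"
    by (rule indep_eventsI_indep_vars) (use Q in \<open>auto simp: pred_def\<close>)
  then have "prob (\<Inter>j\<in>L. {\<omega> \<in> space M. Q j (restrict (\<lambda>i. X i \<omega>) (J j))})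
      = (\<Prod>j\<in>L. \<P>(\<omega> in M. Q j (restrict (\<lambda>i. X i \<omega>) (J j))))"
    using L False unfolding indep_events_def by blast
  moreover have "(\<Inter>j\<in>L. {\<omega> \<in> space M. Q j (restrict (\<lambda>i. X i \<omega>) (J j))})
      = {\<omega> \<in> space M. \<forall>j\<in>L. Q j (\<lambda>v. X v \<omega>)}"
    using False local by auto
  ultimately show ?thesis using local by simp
qed

text \<open>The joint law on \<open>I\<close> is a product of equal factors, hence invariant under
  transposing \<open>a\<close> and \<open>c\<close>, which carries one event to the other.\<close>

lemma prob_max_eq:
  assumes "finite I" "a \<in> I" "c \<in> I"
  shows "\<P>(\<omega> in M. \<forall>f\<in>I - {c}. X f \<omega> < X c \<omega>) = \<P>(\<omega> in M. \<forall>f\<in>I - {a}. X f \<omega> < X a \<omega>)"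
proof -
  let ?U = "uniform_measure lborel {0..1::real}"
  let ?P = "PiM I (\<lambda>_. ?U)"
  let ?t = "Transposition.transpose a c"
  let ?s = "\<lambda>x. \<lambda>i\<in>I. x (?t i)"
  let ?E = "\<lambda>c. {x \<in> space ?P. \<forall>f\<in>I - {c}. x f < x c}"
  have E: "?E c \<in> sets ?P" if "c \<in> I" for c
    using pred_less_components[of "I - {c}" I c "\<lambda>_. ?U"] assms(1) that by (simp add: pred_def)
  have P: "distr M ?P (\<lambda>\<omega>. \<lambda>i\<in>I. X i \<omega>) = ?P"
  proof -
    have "indep_vars (\<lambda>_. borel) X I" using indep_ages by (rule indep_vars_subset) simp
    then have "distr M (\<Pi>\<^sub>M i\<in>I. borel) (\<lambda>\<omega>. \<lambda>i\<in>I. X i \<omega>) = ?P"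
      using assms by (subst (asm) indep_vars_iff_distr_eq_PiM') (auto simp: age_distr)
    moreover have "sets ?P = sets (\<Pi>\<^sub>M i\<in>I. borel)" by (intro sets_PiM_cong) auto
    ultimately show ?thesis by (metis distr_cong)
  qed
  have "(\<lambda>\<omega>. \<lambda>i\<in>I. X i \<omega>) \<in> measurable M ?P"
    by (intro measurable_restrict) simp
  then have prob: "\<P>(\<omega> in M. \<forall>f\<in>I - {c}. X f \<omega> < X c \<omega>) = measure ?P (?E c)" if "c \<in> I" for c
    using that E[OF that] 
    by (subst P[symmetric], subst measure_distr)
      (auto intro!: arg_cong[where f = "measure M"] simp: space_PiM)
  have t: "?t ` I = I" using assms by simp
  have "prob_space ?U" by (rule prob_space_uniform_measure) auto
  then have swap: "distr ?P ?P ?s = ?P"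
    using t by (intro distr_PiM_reindex) (auto intro: inj_on_subset[OF inj_transpose])
  have "measure ?P (?E a) = measure ?P (?s -` ?E a \<inter> space ?P)"
    using E[OF assms(2)] t by (subst swap[symmetric], subst measure_distr) (auto intro!: measurable_restrict measurable_component_singleton)
  also have "?s -` ?E a \<inter> space ?P = ?E c"
  proof -
    have "(\<forall>f\<in>I - {a}. x (?t f) < x c) \<longleftrightarrow> (\<forall>f\<in>?t ` (I - {a}). x f < x c)" for x :: "'i \<Rightarrow> real" by simp
    moreover have "?t ` (I - {a}) = I - {c}"
      using t by (subst image_set_diff) auto
    ultimately have "(\<forall>f\<in>I - {a}. x (?t f) < x c) \<longleftrightarrow> (\<forall>f\<in>I - {c}. x f < x c)" for x :: "'i \<Rightarrow> real" by simp
    then show ?thesis using assms t by (auto simp: space_PiM PiE_iff dest: extensional_arb)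
  qed
  finally show ?thesis using assms by (simp add: prob)
qed

text \<open>At most one of the \<open>card F + 1\<close> vertices is the strict maximum, and by
  symmetry all have the same chance.\<close>

lemma prob_max_le:
  assumes "finite F" "a \<notin> F"
  shows "\<P>(\<omega> in M. \<forall>f\<in>F. X f \<omega> < X a \<omega>) \<le> 1 / (card F + 1)"
proof -
  let ?I = "insert a F"
  let ?E = "\<lambda>c. {\<omega> \<in> space M. \<forall>f\<in>?I - {c}. X f \<omega> < X c \<omega>}"
  have "(card F + 1) * prob (?E a) = (\<Sum>c\<in>?I. prob (?E c))"
    using assms prob_max_eq[of ?I a] by (simp del: insert_Diff_single)
  also have "\<dots> = prob (\<Union>c\<in>?I. ?E c)"
  proof (rule finite_measure_finite_Union[symmetric])
    show "?E ` ?I \<subseteq> events" using assms(1) by auto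
    show "disjoint_family_on ?E ?I"
      unfolding disjoint_family_on_def
    proof (intro ballI impI)
      fix c d assume cd: "c \<in> ?I" "d \<in> ?I" "c \<noteq> d"
      have "\<not> (\<omega> \<in> ?E c \<and> \<omega> \<in> ?E d)" for \<omega>
        using cd less_asym[of "X c \<omega>" "X d \<omega>"] by blast
      then show "?E c \<inter> ?E d = {}" by blast
    qed
  qed (use assms in simp)
  also have "\<dots> \<le> 1" by simp
  finally have "prob (?E a) \<le> 1 / (card F + 1)" by (simp add: field_simps)
  then show ?thesis using assms(2) by simp
qed

text \<open>The first two conditions are independent and give the product. The third fails on a part
  of their intersection of probability at least \<open>(1/4)^6\<close>; this is the gain in
  \<open>decay\<close>.\<close>

lemma prob_pair_le:
  assumes fin: "finite F" "finite G" and card: "card F \<le> 2" "card G \<le> 2" and ne: "F \<noteq> {}"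
    and disj: "insert a F \<inter> insert b G = {}" "a \<notin> F" "b \<notin> G"
  shows "\<P>(\<omega> in M. (\<forall>f\<in>F. X f \<omega> < X a \<omega>) \<and> (\<forall>g\<in>G. X g \<omega> < X b \<omega>) \<and> (\<forall>f\<in>F. X f \<omega> < X b \<omega>))
    \<le> decay * (1 / (card F + 1) * (1 / (card G + 1)))" (is "prob ?ABC \<le> _")
proof -
  let ?A = "\<lambda>x :: 'i \<Rightarrow> real. \<forall>f\<in>F. x f < x a" and ?B = "\<lambda>x :: 'i \<Rightarrow> real. \<forall>g\<in>G. x g < x b"
  let ?AB = "{\<omega> \<in> space M. ?A (\<lambda>v. X v \<omega>) \<and> ?B (\<lambda>v. X v \<omega>)}"
  have ev [measurable]: "?AB \<in> events" "?ABC \<in> events" using fin by measurable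
  have pA: "Measurable.pred (PiM (insert a F) (\<lambda>_. borel)) ?A"
    by (rule pred_less_components[OF fin(1)]) auto
  have pB: "Measurable.pred (PiM (insert b G) (\<lambda>_. borel)) ?B"
    by (rule pred_less_components[OF fin(2)]) auto
  have "\<P>(\<omega> in M. \<forall>j\<in>UNIV. (case_bool ?A ?B j) (\<lambda>v. X v \<omega>))
      = (\<Prod>j\<in>UNIV. \<P>(\<omega> in M. (case_bool ?A ?B j) (\<lambda>v. X v \<omega>)))"
  proof (rule prob_blocks)
    show "disjoint_family_on (case_bool (insert a F) (insert b G)) UNIV"
      using disj by (auto simp: disjoint_family_on_def split: bool.split)
  qed (use pA pB in \<open>auto split: bool.split\<close>)
  then have "prob ?AB = \<P>(\<omega> in M. ?A (\<lambda>v. X v \<omega>)) * \<P>(\<omega> in M. ?B (\<lambda>v. X v \<omega>))"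
    by (simp add: UNIV_bool ex_bool_eq conj_commute mult.commute)
  also have "\<dots> \<le> 1 / (card F + 1) * (1 / (card G + 1))"
    using fin disj by (intro mult_mono prob_max_le) auto
  finally have AB: "prob ?AB \<le> 1 / (card F + 1) * (1 / (card G + 1))" .
  let ?I = "insert a F \<union> insert b G"
  \<comment> \<open>The quarters of the unit interval, from the lowest up, are reserved for
    \<open>G\<close>, \<open>b\<close>, \<open>F\<close> and \<open>a\<close>: then \<open>a\<close>
    beats \<open>F\<close> and \<open>b\<close> beats \<open>G\<close>, but \<open>b\<close> stays
    below \<open>F\<close>.\<close>
  define l where "l v = (if v \<in> G then 0 else if v = b then 1/4 else if v \<in> F then 1/2 else 3/4 :: real)" for v
  let ?Q = "{\<omega> \<in> space M. \<forall>v\<in>?I. l v < X v \<omega> \<and> X v \<omega> < l v + 1/4}"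
  have "prob ?Q = (\<Prod>v\<in>?I. \<P>(\<omega> in M. l v < X v \<omega> \<and> X v \<omega> < l v + 1/4))"
    by (rule prob_blocks[of ?I "\<lambda>v. {v}" "\<lambda>v x. l v < x v \<and> x v < l v + 1/4"])
      (use fin in \<open>auto simp: disjoint_family_on_def\<close>)
  also have "\<dots> = (1/4) ^ card ?I"
    using prob_age_interval[of "l _" "l _ + 1/4"] by (simp add: l_def)
  \<comment> \<open>At most six ages are confined to a quarter: those of \<open>a\<close>, of
    \<open>b\<close>, and of at most two vertices each in \<open>F\<close> and
    \<open>G\<close>.\<close>
  also have "\<dots> \<ge> (1/4) ^ 6"
  proof (rule power_decreasing)
    have "card ?I \<le> card (insert a F) + card (insert b G)" by (rule card_Un_le)
    also have "\<dots> \<le> 6" using card card_insert_le_m1[of 3 F a] card_insert_le_m1[of 3 G b] by simp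
    finally show "card ?I \<le> 6" .
  qed auto
  finally have Q: "(1/4) ^ 6 \<le> prob ?Q" .
  have sub: "?Q \<subseteq> ?AB - ?ABC"
  proof
    fix \<omega> assume \<omega>: "\<omega> \<in> ?Q"
    have l: "l a = 3/4" "l b = 1/4" "\<And>f. f \<in> F \<Longrightarrow> l f = 1/2" "\<And>g. g \<in> G \<Longrightarrow> l g = 0"
      using disj by (auto simp: l_def)
    have X: "l v < X v \<omega>" "X v \<omega> < l v + 1/4" if "v \<in> ?I" for v using \<omega> that by auto
    have a: "3/4 < X a \<omega>" and b: "1/4 < X b \<omega>" "X b \<omega> < 1/2"
      using X[of a] X[of b] l by auto
    have f: "1/2 < X f \<omega> \<and> X f \<omega> < 3/4" if "f \<in> F" for f using X[of f] l(3)[OF that] that by auto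
    have g: "X g \<omega> < 1/4" if "g \<in> G" for g using X[of g] l(4)[OF that] that by auto
    have "\<forall>f\<in>F. X f \<omega> < X a \<omega>" using f a by fastforce
    moreover have "\<forall>g\<in>G. X g \<omega> < X b \<omega>" using g b by fastforce
    moreover have "\<not> (\<forall>f\<in>F. X f \<omega> < X b \<omega>)" using f b ne by fastforce
    ultimately show "\<omega> \<in> ?AB - ?ABC" using \<omega> by blast
  qed
  have "prob ?Q \<le> prob (?AB - ?ABC)" using sub by (intro finite_measure_mono) auto
  also have "\<dots> = prob ?AB - prob ?ABC" by (intro finite_measure_Diff) auto
  finally have "prob ?ABC \<le> 1 / (card F + 1) * (1 / (card G + 1)) - (1/4)^6"
    using Q AB by linarith
  \<comment> \<open>The product is at most 1, so subtracting \<open>(1/4)^6\<close> removes at least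
    that fraction of it.\<close>
  also have "(1/4::real)^6 * (1 / (card F + 1) * (1 / (card G + 1))) \<le> (1/4)^6"
    by (intro mult_left_le mult_le_one) auto
  then have "1 / (card F + 1) * (1 / (card G + 1)) - (1/4)^6
      \<le> decay * (1 / (card F + 1) * (1 / (card G + 1)))"
    by (simp only: decay_def left_diff_distrib mult_1_left)
  finally show ?thesis .
qed

end

section \<open>Chordless diagonal paths and their total weight\<close>

definition chordless :: "nat \<Rightarrow> (nat \<Rightarrow> int \<times> int) \<Rightarrow> bool" where
  "chordless n p \<longleftrightarrow> (\<forall>i<n. p (Suc i) \<in> diags (p i)) \<and>
     (\<forall>j\<le>n. \<forall>i. i + 2 \<le> j \<longrightarrow> p j \<noteq> p i \<and> p j \<notin> diags (p i))"

lemma chordless_mono: "chordless n p \<Longrightarrow> m \<le> n \<Longrightarrow> chordless m p"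
  by (auto simp: chordless_def)

lemma chordless_cong: "(\<And>i. i \<le> n \<Longrightarrow> p i = q i) \<Longrightarrow> chordless n p = chordless n q"
  by (simp add: chordless_def)

text \<open>Paths are total functions; pinning the values past \<open>n\<close> to \<open>v\<close>
  makes the set finite and represents each path once.\<close>

definition chordless_paths :: "int \<times> int \<Rightarrow> nat \<Rightarrow> (nat \<Rightarrow> int \<times> int) set" where
  "chordless_paths v n = {p. p 0 = v \<and> chordless n p \<and> (\<forall>i>n. p i = v)}"

definition extensions :: "nat \<Rightarrow> (nat \<Rightarrow> int \<times> int) \<Rightarrow> (int \<times> int) set" where
  "extensions n p = {x \<in> diags (p n). \<forall>i<n. x \<noteq> p i \<and> x \<notin> diags (p i)}"

text \<open>Excluding the neighbours of the previous vertex keeps these sets disjoint along a path.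
  Requiring that the next vertex share them means that it must beat them too, which
  \<open>prob_pair_le\<close> exploits.\<close>

definition fresh :: "(nat \<Rightarrow> int \<times> int) \<Rightarrow> nat \<Rightarrow> (int \<times> int) set" where
  "fresh p i = nbrs (p i) \<inter> nbrs (p (Suc i)) - nbrs (p (i - 1))"

text \<open>Each factor is the bound of \<open>prob_max_le\<close>. The product starts at 1, as
  vertex 0 has no predecessor, and stops before \<open>n\<close>, as \<open>fresh p n\<close> looks
  at vertex \<open>n + 1\<close>.\<close>

definition weight :: "nat \<Rightarrow> (nat \<Rightarrow> int \<times> int) \<Rightarrow> real" where
  "weight n p = (\<Prod>i\<in>{1..<n}. 1 / (card (fresh p i) + 1))"

lemma finite_nbrs [simp]: "finite (nbrs v)"
  by (cases v) simp

lemma finite_diags [simp]: "finite (diags v)"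
  by (cases v) simp

lemma finite_fresh [simp]: "finite (fresh p i)"
  by (simp add: fresh_def)

lemma finite_extensions [simp]: "finite (extensions n p)"
  by (simp add: extensions_def)

lemma card_diags_le: "card (diags v) \<le> 4"
  by (cases v) simp

lemma chordless_paths_Suc:
  "chordless_paths v (Suc n) \<subseteq>
     (\<lambda>(p, x). p(Suc n := x)) ` (SIGMA p:chordless_paths v n. extensions n p)"
proof
  fix p assume p: "p \<in> chordless_paths v (Suc n)"
  let ?q = "p(Suc n := v)"
  have "chordless n ?q = chordless n p" by (rule chordless_cong) simp
  then have "?q \<in> chordless_paths v n"
    using p chordless_mono[of "Suc n" p n] by (auto simp: chordless_paths_def)
  moreover have "p (Suc n) \<in> extensions n ?q"
  proof -
    have "p (Suc n) \<noteq> p i \<and> p (Suc n) \<notin> diags (p i)" if "i < n" for i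
    proof -
      have "i + 2 \<le> Suc n" using that by simp
      then show ?thesis using p unfolding chordless_paths_def chordless_def by blast
    qed
    then show ?thesis using p by (auto simp: extensions_def chordless_paths_def chordless_def)
  qed
  moreover have "p = ?q(Suc n := p (Suc n))" by simp
  ultimately show "p \<in> (\<lambda>(p, x). p(Suc n := x)) ` (SIGMA p:chordless_paths v n. extensions n p)"
    by (intro image_eqI[of _ _ "(?q, p (Suc n))"]) auto
qed

lemma finite_chordless_paths [simp]: "finite (chordless_paths v n)"
proof (induction n)
  case 0
  have "chordless_paths v 0 \<subseteq> {\<lambda>_. v}" 
    by (auto simp: chordless_paths_def fun_eq_iff) (metis gr0I)
  then show ?case by (rule finite_subset) simp
next
  case (Suc n)
  then show ?case
    by (intro finite_subset[OF chordless_paths_Suc] finite_imageI finite_SigmaI) auto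
qed

lemma weight_nonneg: "0 \<le> weight n p"
  by (simp add: weight_def prod_nonneg)

lemma weight_cong: "(\<And>i. i \<le> n \<Longrightarrow> p i = q i) \<Longrightarrow> weight n p = weight n q"
  by (auto simp: weight_def fresh_def intro!: prod.cong)

lemma weight_Suc: "1 \<le> n \<Longrightarrow> weight (Suc n) p = weight n p / (card (fresh p n) + 1)"
  by (simp add: weight_def prod.atLeastLessThan_Suc)

lemma weight_Suc_le: "weight (Suc n) p \<le> weight n p"
proof (cases "1 \<le> n")
  case True
  have "weight n p / (card (fresh p n) + 1) \<le> weight n p / 1"
    using weight_nonneg[of n p] by (intro divide_left_mono) auto
  then show ?thesis using True by (simp add: weight_Suc)
next
  case False
  then show ?thesis by (simp add: weight_def)
qed

text \<open>A summand that ignores the last vertex is counted at most once for each extension of the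
  shorter path.\<close>

lemma sum_chordless_paths_Suc:
  assumes "\<And>p x. f (p(Suc n := x)) = f p" "\<And>p. 0 \<le> f p"
  shows "(\<Sum>p\<in>chordless_paths v (Suc n). f p) \<le>
    (\<Sum>p\<in>chordless_paths v n. real (card (extensions n p)) * f p)"
proof -
  let ?S = "SIGMA p:chordless_paths v n. extensions n p"
  have "(\<Sum>p\<in>chordless_paths v (Suc n). f p) \<le> (\<Sum>p\<in>(\<lambda>(p, x). p(Suc n := x)) ` ?S. f p)"
    by (rule sum_mono2[OF _ chordless_paths_Suc]) (use assms in auto)
  also have "\<dots> \<le> (\<Sum>px\<in>?S. f ((\<lambda>(p, x). p(Suc n := x)) px))"
    by (rule order_trans[OF sum_image_le]) (use assms in \<open>auto simp: o_def\<close>)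
  also have "\<dots> = (\<Sum>p\<in>chordless_paths v n. \<Sum>x\<in>extensions n p. f p)"
    by (subst sum.Sigma) (auto simp: assms split_def intro!: sum.cong)
  finally show ?thesis by simp
qed

text \<open>Going straight, a path has two fresh grid neighbours and three ways to go on; after a turn it
  has one and two, because one continuation would close a square.\<close>

lemma
  assumes ab: "b \<in> diags a" and bc: "c \<in> diags b" and "c \<noteq> a" "c \<notin> diags a"
  shows continuations_le:
      "card (diags c - insert b (diags a)) \<le> card (nbrs b \<inter> nbrs c - nbrs a) + 1"
    and fresh_triple: "nbrs b \<inter> nbrs c - nbrs a \<noteq> {}" "card (nbrs b \<inter> nbrs c - nbrs a) \<le> 2"
proof -
  obtain x y where a: "a = (x, y)" by (cases a)
  consider "b = (x + 1, y + 1)" | "b = (x - 1, y - 1)" | "b = (x + 1, y - 1)" | "b = (x - 1, y + 1)"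
    using ab by (auto simp: a)
  then have "card (diags c - insert b (diags a)) \<le> card (nbrs b \<inter> nbrs c - nbrs a) + 1 \<and>
    nbrs b \<inter> nbrs c - nbrs a \<noteq> {} \<and> card (nbrs b \<inter> nbrs c - nbrs a) \<le> 2"
  proof cases
    case 1
    then have "c = (fst b + 1, snd b + 1) \<or> c = (fst b - 1, snd b - 1) \<or>
        c = (fst b + 1, snd b - 1) \<or> c = (fst b - 1, snd b + 1)"
      using bc by auto
    then show ?thesis
      using assms(3,4) 1
      by (elim disjE) (simp_all add: a Int_insert_left insert_Diff_if card_insert_if)
  next
    case 2
    then have "c = (fst b + 1, snd b + 1) \<or> c = (fst b - 1, snd b - 1) \<or>
        c = (fst b + 1, snd b - 1) \<or> c = (fst b - 1, snd b + 1)"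
      using bc by auto
    then show ?thesis
      using assms(3,4) 2
      by (elim disjE) (simp_all add: a Int_insert_left insert_Diff_if card_insert_if)
  next
    case 3
    then have "c = (fst b + 1, snd b + 1) \<or> c = (fst b - 1, snd b - 1) \<or>
        c = (fst b + 1, snd b - 1) \<or> c = (fst b - 1, snd b + 1)"
      using bc by auto
    then show ?thesis
      using assms(3,4) 3
      by (elim disjE) (simp_all add: a Int_insert_left insert_Diff_if card_insert_if)
  next
    case 4
    then have "c = (fst b + 1, snd b + 1) \<or> c = (fst b - 1, snd b - 1) \<or>
        c = (fst b + 1, snd b - 1) \<or> c = (fst b - 1, snd b + 1)"
      using bc by auto
    then show ?thesis
      using assms(3,4) 4
      by (elim disjE) (simp_all add: a Int_insert_left insert_Diff_if card_insert_if)
  qed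
  then show "card (diags c - insert b (diags a)) \<le> card (nbrs b \<inter> nbrs c - nbrs a) + 1"
    "nbrs b \<inter> nbrs c - nbrs a \<noteq> {}" "card (nbrs b \<inter> nbrs c - nbrs a) \<le> 2" by auto
qed

lemma chordless_triple:
  assumes "chordless n p" "1 \<le> i" "Suc i \<le> n"
  shows "p i \<in> diags (p (i - 1))" "p (Suc i) \<in> diags (p i)"
    "p (Suc i) \<noteq> p (i - 1)" "p (Suc i) \<notin> diags (p (i - 1))"
proof -
  obtain k where k: "i = Suc k" using assms(2) by (cases i) auto
  have s: "p (Suc j) \<in> diags (p j)" if "j < n" for j using assms(1) that by (auto simp: chordless_def)
  show "p i \<in> diags (p (i - 1))" "p (Suc i) \<in> diags (p i)"
    using s[of k] s[of i] assms(3) by (simp_all add: k)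
  have "k + 2 \<le> Suc i" by (simp add: k)
  then show "p (Suc i) \<noteq> p (i - 1)" "p (Suc i) \<notin> diags (p (i - 1))"
    using assms(1,3) unfolding chordless_def by (auto simp: k)
qed

lemma
  assumes "chordless n p" "1 \<le> i" "Suc i \<le> n"
  shows fresh_nonempty: "fresh p i \<noteq> {}" and card_fresh_le: "card (fresh p i) \<le> 2"
  unfolding fresh_def by (rule fresh_triple[OF chordless_triple[OF assms]])+

lemma card_extensions_le:
  assumes "p \<in> chordless_paths v (Suc n)" "1 \<le> n"
  shows "card (extensions (Suc n) p) \<le> card (fresh p n) + 1"
proof -
  have c: "chordless (Suc n) p" using assms by (simp add: chordless_paths_def)
  have "extensions (Suc n) p \<subseteq> diags (p (Suc n)) - insert (p n) (diags (p (n - 1)))"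
    using assms(2) by (auto simp: extensions_def)
  then have "card (extensions (Suc n) p) \<le> card (diags (p (Suc n)) - insert (p n) (diags (p (n - 1))))"
    by (rule card_mono[rotated]) simp
  also have "\<dots> \<le> card (fresh p n) + 1"
    unfolding fresh_def
    by (rule continuations_le[OF chordless_triple[OF c assms(2) order_refl]])
  finally show ?thesis .
qed

text \<open>Each factor of the weight is at most the reciprocal of the number of ways to take the step that
  follows it, so the total weight does not grow with the length.\<close>

lemma sum_weight_le: "(\<Sum>p\<in>chordless_paths v (n + 2). weight (n + 1) p) \<le> 16"
proof (induction n)
  case 0
  \<comment> \<open>A step has at most four choices. For two steps, with \<open>weight 1 p\<close>
    an empty product, this gives 16.\<close>
  have card: "(\<Sum>p\<in>chordless_paths v (Suc m). 1 :: real) \<le> 4 * (\<Sum>p\<in>chordless_paths v m. 1)" for m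
  proof -
    have "(\<Sum>p\<in>chordless_paths v (Suc m). 1 :: real) \<le> (\<Sum>p\<in>chordless_paths v m. real (card (extensions m p)) * 1)"
      by (rule sum_chordless_paths_Suc) auto
    also have "\<dots> \<le> (\<Sum>p\<in>chordless_paths v m. 4 * 1)"
    proof (intro sum_mono mult_right_mono)
      fix p
      have "card (extensions m p) \<le> card (diags (p m))"
        by (rule card_mono) (auto simp: extensions_def)
      then show "real (card (extensions m p)) \<le> 4" using card_diags_le[of "p m"] by linarith
    qed auto
    finally show ?thesis by simp
  qed
  have "card (chordless_paths v 0) \<le> card {\<lambda>_::nat. v}"
    by (rule card_mono) (auto simp: chordless_paths_def fun_eq_iff, metis gr0I)
  then show ?case using card[of 0] card[of 1] by (simp add: weight_def eval_nat_numeral)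
next
  case (Suc n)
  have "(\<Sum>p\<in>chordless_paths v (Suc (n + 2)). weight (n + 2) p)
      \<le> (\<Sum>p\<in>chordless_paths v (n + 2). real (card (extensions (n + 2) p)) * weight (n + 2) p)"
    by (rule sum_chordless_paths_Suc) (auto simp: weight_nonneg intro!: weight_cong)
  also have "\<dots> \<le> (\<Sum>p\<in>chordless_paths v (n + 2). weight (n + 1) p)"
  proof (rule sum_mono)
    fix p assume p: "p \<in> chordless_paths v (n + 2)"
    have "card (extensions (n + 2) p) \<le> card (fresh p (n + 1)) + 1"
      using card_extensions_le[of p v "n + 1"] p by simp
    then have "real (card (extensions (n + 2) p)) * weight (n + 2) p
        \<le> (card (fresh p (n + 1)) + 1) * weight (n + 2) p"
      by (intro mult_right_mono weight_nonneg) simp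
    also have "\<dots> = weight (n + 1) p"
      using weight_Suc[of "n + 1" p] by (simp add: field_simps)
    finally show "real (card (extensions (n + 2) p)) * weight (n + 2) p \<le> weight (n + 1) p" .
  qed
  also have "\<dots> \<le> 16" by (rule Suc.IH)
  finally show ?case by simp
qed

section \<open>Disjoint blocks along a chordless path\<close>

lemma chordless_parity:
  assumes "chordless n p" "i \<le> n"
  shows "even (fst (p i) + snd (p i)) = even (fst (p 0) + snd (p 0))"
  using assms(2)
proof (induction i)
  case (Suc i)
  then have "p (Suc i) \<in> diags (p i)" using assms(1) by (simp add: chordless_def)
  then have "even (fst (p (Suc i)) + snd (p (Suc i))) = even (fst (p i) + snd (p i))"
    by (cases "p i"; cases "p (Suc i)") auto
  then show ?case using Suc by simp
qed simp

text \<open>Grid steps change the checkerboard colour while diagonal steps keep it, so no vertex of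
  a path is a fresh neighbour.\<close>

lemma nbrs_parity: "u \<in> nbrs v \<Longrightarrow> even (fst u + snd u) \<noteq> even (fst v + snd v)"
  by (cases u; cases v) auto

text \<open>Among the four grid neighbours of \<open>f\<close>, only the one opposite to
  \<open>a\<close> is neither \<open>a\<close> nor diagonal to \<open>a\<close>.\<close>

lemma opposite_nbr_unique:
  assumes "a \<in> nbrs f" "b \<in> nbrs f" "c \<in> nbrs f" "b \<noteq> a" "c \<noteq> a" "b \<notin> diags a" "c \<notin> diags a"
  shows "b = c"
proof -
  have "u = a \<or> u \<in> diags a \<or> u = (2 * fst f - fst a, 2 * snd f - snd a)" if "u \<in> nbrs f" for u
    using assms(1) that by (cases f) (auto simp: algebra_simps)
  from this[of b] this[of c] show ?thesis using assms by blast
qed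

text \<open>Consecutive fresh sets are disjoint by definition. For vertices further apart, a common
  fresh neighbour would have both \<open>p j\<close> and \<open>p (Suc j)\<close> opposite to
  \<open>p i\<close>, although they differ.\<close>

lemma fresh_disjoint:
  assumes p: "chordless n p" and ij: "1 \<le> i" "i < j" "Suc j \<le> n"
  shows "insert (p i) (fresh p i) \<inter> insert (p j) (fresh p j) = {}"
proof -
  have par: "p k \<notin> fresh p l" if "k \<le> n" "l \<le> n" for k l
    using chordless_parity[OF p that(1)] chordless_parity[OF p that(2)] nbrs_parity[of "p k" "p l"]
    by (auto simp: fresh_def)
  have far: "p l \<noteq> p k \<and> p l \<notin> diags (p k)" if "k + 2 \<le> l" "l \<le> n" for k l
    using p that unfolding chordless_def by blast
  have step: "p (Suc k) \<in> diags (p k)" if "k < n" for k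
    using p that by (simp add: chordless_def)
  have irr: "v \<notin> diags v" for v by (cases v) auto
  have "p i \<noteq> p j"
  proof (cases "j = Suc i")
    case True
    then have "p j \<in> diags (p i)" using step[of i] ij by simp
    then show ?thesis using irr[of "p i"] by auto
  next
    case False
    then show ?thesis using far[of i j] ij by auto
  qed
  moreover have "fresh p i \<inter> fresh p j = {}"
  proof (cases "j = Suc i")
    case True
    then show ?thesis by (auto simp: fresh_def)
  next
    case False
    have "f \<notin> fresh p j" if f: "f \<in> fresh p i" for f
    proof
      assume "f \<in> fresh p j"
      then have "p i \<in> nbrs f" "p j \<in> nbrs f" "p (Suc j) \<in> nbrs f"
        using f by (simp_all add: fresh_def nbrs_sym[of f])
      then have "p j = p (Suc j)"
        using far[of i j] far[of i "Suc j"] ij False by (intro opposite_nbr_unique) auto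
      then show False using step[of j] ij irr by auto
    qed
    then show ?thesis by blast
  qed
  ultimately show ?thesis using par[of i j] par[of j i] ij by auto
qed

section \<open>Diagonal clusters and shortest paths\<close>

lemma diag_links_geodesic:
  assumes "(v, w) \<in> (diag_links D)\<^sup>*"
  obtains n f where "f 0 = v" "f n = w" "\<And>i. i < n \<Longrightarrow> (f i, f (Suc i)) \<in> diag_links D" "chordless n f"
proof -
  let ?R = "diag_links D"
  define n where "n = (LEAST n. (v, w) \<in> ?R ^^ n)"
  have ex: "\<exists>n. (v, w) \<in> ?R ^^ n" using assms rtrancl_power by blast
  have n: "(v, w) \<in> ?R ^^ n" unfolding n_def by (rule LeastI_ex[OF ex])
  have least: "n \<le> k" if "(v, w) \<in> ?R ^^ k" for k using that unfolding n_def by (rule Least_le)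
  obtain f where f: "f 0 = v" "f n = w" "\<And>i. i < n \<Longrightarrow> (f i, f (Suc i)) \<in> ?R"
    using n by (auto simp: relpow_fun_conv)
  have seg: "(f i, f (i + k)) \<in> ?R ^^ k" if "i + k \<le> n" for i k
    unfolding relpow_fun_conv
  proof (intro exI conjI allI impI)
    show "(f (i + l), f (i + Suc l)) \<in> ?R" if "l < k" for l
      using f(3)[of "i + l"] that \<open>i + k \<le> n\<close> by simp
  qed simp_all
  \<comment> \<open>A chord would replace at least two steps of a shortest path by at most
    one.\<close>
  have "f j \<noteq> f i \<and> f j \<notin> diags (f i)" if ij: "i + 2 \<le> j" "j \<le> n" for i j
  proof (rule ccontr)
    assume "\<not> ?thesis"
    moreover have "f i \<in> D" "f j \<in> D"
      using f(3)[of i] f(3)[of "j - 1"] ij by (auto simp: diag_links_def)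
    ultimately have "f i = f j \<or> (f i, f j) \<in> ?R"
      by (auto simp: diag_links_def)
    then have "(f i, f j) \<in> ?R ^^ 0 \<or> (f i, f j) \<in> ?R ^^ 1" by simp
    then obtain k where k: "k \<le> 1" "(f i, f j) \<in> ?R ^^ k" by (meson le_refl zero_le_one)
    have "(v, f i) \<in> ?R ^^ i" using seg[of 0 i] ij f(1) by simp
    moreover have "(f j, w) \<in> ?R ^^ (n - j)" using seg[of j "n - j"] ij f(2) by simp
    ultimately have "(v, w) \<in> ?R ^^ (i + k + (n - j))"
      using k(2) by (meson relpow_trans)
    then have "n \<le> i + k + (n - j)" by (rule least)
    then show False using ij k by linarith
  qed
  moreover have "f (Suc i) \<in> diags (f i)" if "i < n" for i
    using f(3)[OF that] by (simp add: diag_links_def)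
  ultimately have "chordless n f" by (simp add: chordless_def)
  with f show ?thesis by (rule that)
qed

text \<open>A shortest path with at least \<open>n\<close> steps, cut after \<open>n\<close> of
  them, would be a chordless path in \<open>D\<close>. So \<open>w\<close> is reached in fewer
  steps, each moving a coordinate by at most 1.\<close>

lemma cluster_within:
  assumes no: "\<not> (\<exists>p\<in>chordless_paths v n. \<forall>i\<le>n. p i \<in> D)" and n: "1 \<le> n"
    and vw: "(v, w) \<in> (diag_links D)\<^sup>*"
  shows "\<bar>fst w - fst v\<bar> < int n \<and> \<bar>snd w - snd v\<bar> < int n"
proof -
  obtain k f where f: "f 0 = v" "f k = w" "\<And>i. i < k \<Longrightarrow> (f i, f (Suc i)) \<in> diag_links D" "chordless k f"
    by (rule diag_links_geodesic[OF vw]) (rule that)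
  have "k < n"
  proof (rule ccontr)
    assume "\<not> k < n"
    then have nk: "n \<le> k" by simp
    let ?p = "\<lambda>i. if i \<le> n then f i else v"
    have "chordless n ?p = chordless n f" by (rule chordless_cong) simp
    then have "?p \<in> chordless_paths v n"
      using chordless_mono[OF f(4) nk] f(1) by (simp add: chordless_paths_def)
    moreover have "?p i \<in> D" if "i \<le> n" for i
    proof (cases i)
      case 0
      then show ?thesis using f(3)[of 0] n nk by (auto simp: diag_links_def)
    next
      case (Suc l)
      then show ?thesis using f(3)[of l] that nk by (auto simp: diag_links_def)
    qed
    ultimately have "\<exists>p\<in>chordless_paths v n. \<forall>i\<le>n. p i \<in> D" by (intro bexI[of _ ?p] allI impI)
    then show False using no by contradiction
  qed
  have step: "\<bar>fst b - fst a\<bar> \<le> 1 \<and> \<bar>snd b - snd a\<bar> \<le> 1" if "b \<in> diags a" for a b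
    using that by (cases a) auto
  have "\<bar>fst (f i) - fst v\<bar> \<le> int i \<and> \<bar>snd (f i) - snd v\<bar> \<le> int i" if "i \<le> k" for i
    using that
  proof (induction i)
    case (Suc i)
    have "f (Suc i) \<in> diags (f i)" using f(3)[of i] Suc.prems by (simp add: diag_links_def)
    then have "\<bar>fst (f (Suc i)) - fst (f i)\<bar> \<le> 1 \<and> \<bar>snd (f (Suc i)) - snd (f i)\<bar> \<le> 1"
      using step by blast
    moreover have "\<bar>fst (f i) - fst v\<bar> \<le> int i \<and> \<bar>snd (f i) - snd v\<bar> \<le> int i"
      using Suc by simp
    ultimately show ?case by linarith
  qed (simp add: f(1))
  from this[of k] show ?thesis using f(2) \<open>k < n\<close> by simp
qed

section \<open>Strict local maxima of the ages\<close>

definition peaks :: "(int \<times> int \<Rightarrow> real) \<Rightarrow> (int \<times> int) set" where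
  "peaks x = {v. \<forall>u\<in>nbrs v. x u < x v}"

lemma peaks_indep: "u \<in> peaks x \<Longrightarrow> v \<in> nbrs u \<Longrightarrow> v \<notin> peaks x"
  using nbrs_sym[of u v] less_asym[of "x u" "x v"] unfolding peaks_def by blast

text \<open>All degrees are 4, so only a vertex whose neighbours are all younger escapes the first
  four layers.\<close>

lemma layers_upto_grid2: "layers_upto grid2 x 4 = - peaks x"
proof -
  have four: "card (nbrs v) = 4" for v by (cases v) simp
  have "v \<in> layers_upto grid2 x 4 \<longleftrightarrow> v \<notin> peaks x" for v
  proof -
    let ?Y = "younger_nbrs grid2 x v"
    have Y: "?Y = {u \<in> nbrs v. x u < x v}" by (auto simp: younger_nbrs_def grid2_iff)
    then have fin: "finite ?Y" by simp
    have "v \<in> layers_upto grid2 x 4 \<longleftrightarrow> card ?Y < card (nbrs v)"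
      using fin by (simp add: layers_upto_def layer_def four) linarith
    also have "\<dots> \<longleftrightarrow> ?Y \<noteq> nbrs v"
    proof -
      have "?Y \<subseteq> nbrs v" using Y by blast
      then show ?thesis by (metis finite_nbrs less_irrefl psubsetI psubset_card_mono)
    qed
    also have "\<dots> \<longleftrightarrow> v \<notin> peaks x"
      unfolding Y by (auto simp: peaks_def)
    finally show ?thesis .
  qed
  then show ?thesis by blast
qed

section \<open>Exponential decay for paths of local maxima\<close>

locale grid_ages = iid_ages M X for M :: "'a measure" and X :: "int \<times> int \<Rightarrow> 'a \<Rightarrow> real"
begin

lemma pred_peaks: "Measurable.pred M (\<lambda>\<omega>. v \<in> peaks (\<lambda>v. X v \<omega>))"
proof -
  have "Measurable.pred M (\<lambda>\<omega>. \<forall>u\<in>nbrs v. X u \<omega> < X v \<omega>)"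
    by (rule pred_intros_finite(3)[OF finite_nbrs]) simp
  then show ?thesis by (simp add: peaks_def)
qed

lemma pred_path_peaks: "Measurable.pred M (\<lambda>\<omega>. \<forall>i\<le>n. p i \<in> peaks (\<lambda>v. X v \<omega>))" for n :: nat
proof -
  have "Measurable.pred M (\<lambda>\<omega>. \<forall>i\<in>{..n}. p i \<in> peaks (\<lambda>v. X v \<omega>))"
    by (rule pred_intros_finite(3)[OF finite_atMost pred_peaks])
  then show ?thesis by (simp only: Ball_def atMost_iff)
qed

lemma pred_some_path_peaks:
  "Measurable.pred M (\<lambda>\<omega>. \<exists>p\<in>chordless_paths v n. \<forall>i\<le>n. p i \<in> peaks (\<lambda>v. X v \<omega>))"
  by (rule pred_intros_finite(4)[OF finite_chordless_paths pred_path_peaks])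

text \<open>The vertices 1 to \<open>2 * m\<close> are taken in consecutive pairs. Their blocks are
  disjoint, hence independent, and each pair contributes two factors of the weight and one factor
  \<open>decay\<close>.\<close>

lemma prob_chordless_path_le:
  assumes p: "p \<in> chordless_paths v (2 * m + 1)"
  shows "\<P>(\<omega> in M. \<forall>i\<le>2 * m + 1. p i \<in> peaks (\<lambda>v. X v \<omega>)) \<le> decay ^ m * weight (2 * m + 1) p"
proof -
  let ?n = "2 * m + 1"
  have c: "chordless ?n p" using p by (simp add: chordless_paths_def)
  define a b where "a j = 2 * j + 1" and "b j = 2 * j + 2" for j :: nat
  have ab: "1 \<le> a j" "a j < b j" "Suc (b j) \<le> ?n" "Suc (a j) \<le> ?n" "1 \<le> b j" "b j = Suc (a j)" if "j < m" for j
    using that by (auto simp: a_def b_def)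
  define J where "J j = insert (p (a j)) (fresh p (a j)) \<union> insert (p (b j)) (fresh p (b j))" for j
  \<comment> \<open>The third condition is where the gain arises: the fresh neighbours of the first
    vertex of a pair are also neighbours of the second.\<close>
  define Q where "Q j x \<longleftrightarrow> (\<forall>f\<in>fresh p (a j). x f < x (p (a j))) \<and> (\<forall>g\<in>fresh p (b j). x g < x (p (b j)))
    \<and> (\<forall>f\<in>fresh p (a j). x f < x (p (b j)))" for j and x :: "int \<times> int \<Rightarrow> real"
  have Jd: "J i \<inter> J j = {}" if "i < j" "j < m" for i j
  proof -
    have "i < m" and "b i < a j" using that by (auto simp: a_def b_def)
    then have "insert (p k) (fresh p k) \<inter> insert (p l) (fresh p l) = {}"
      if "k \<in> {a i, b i}" "l \<in> {a j, b j}" for k l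
      using that ab[of i] ab[of j] \<open>j < m\<close> by (intro fresh_disjoint[OF c]) auto
    then show ?thesis unfolding J_def by blast
  qed
  have "\<P>(\<omega> in M. \<forall>i\<le>?n. p i \<in> peaks (\<lambda>v. X v \<omega>)) \<le> \<P>(\<omega> in M. \<forall>j\<in>{..<m}. Q j (\<lambda>v. X v \<omega>))"
  proof (rule finite_measure_mono)
    show "{\<omega> \<in> space M. \<forall>j\<in>{..<m}. Q j (\<lambda>v. X v \<omega>)} \<in> events"
    proof -
      have less: "Measurable.pred M (\<lambda>\<omega>. X u \<omega> < X v \<omega>)" for u v by measurable
      have "Measurable.pred M (\<lambda>\<omega>. \<forall>f\<in>fresh p i. X f \<omega> < X v \<omega>)" for i v
        by (rule pred_intros_finite(3)[OF finite_fresh less])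
      then have "Measurable.pred M (\<lambda>\<omega>. Q j (\<lambda>v. X v \<omega>))" for j
        unfolding Q_def by (intro pred_intros_logic(3))
      from predE[OF pred_intros_finite(3)[OF finite_lessThan this]] show ?thesis .
    qed
    have "Q j x" if "j < m" "\<forall>i\<le>?n. p i \<in> peaks x" for j x
    proof -
      have "p (a j) \<in> peaks x" "p (b j) \<in> peaks x" using that ab[of j] by auto
      then show ?thesis using ab(6)[OF that(1)] by (auto simp: Q_def peaks_def fresh_def)
    qed
    then show "{\<omega> \<in> space M. \<forall>i\<le>?n. p i \<in> peaks (\<lambda>v. X v \<omega>)}
        \<subseteq> {\<omega> \<in> space M. \<forall>j\<in>{..<m}. Q j (\<lambda>v. X v \<omega>)}" by auto
  qed
  also have "\<dots> = (\<Prod>j\<in>{..<m}. \<P>(\<omega> in M. Q j (\<lambda>v. X v \<omega>)))"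
  proof (rule prob_blocks[where J = J and Q = Q and L = "{..<m}"])
    show "disjoint_family_on J {..<m}"
      unfolding disjoint_family_on_def using Jd by (metis Int_commute lessThan_iff linorder_neqE_nat)
    show "Measurable.pred (PiM (J j) (\<lambda>_. borel)) (Q j)" for j
      unfolding Q_def by (intro pred_intros_logic(3) pred_less_components) (auto simp: J_def)
    show "Q j (restrict x (J j)) = Q j x" for j x
      by (auto simp: Q_def J_def)
  qed simp
  also have "\<dots> \<le> (\<Prod>j\<in>{..<m}. decay * (1 / (card (fresh p (a j)) + 1) * (1 / (card (fresh p (b j)) + 1))))"
  proof (rule prod_mono, rule conjI)
    fix j assume "j \<in> {..<m}"
    then have j: "j < m" by simp
    show "\<P>(\<omega> in M. Q j (\<lambda>v. X v \<omega>)) \<le> decay * (1 / (card (fresh p (a j)) + 1) * (1 / (card (fresh p (b j)) + 1)))"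
      unfolding Q_def
    proof (rule prob_pair_le[where F = "fresh p (a j)" and G = "fresh p (b j)" and a = "p (a j)" and b = "p (b j)"])
      show "p (a j) \<notin> fresh p (a j)" "p (b j) \<notin> fresh p (b j)"
        using nbrs_parity[of "p (a j)" "p (a j)"] nbrs_parity[of "p (b j)" "p (b j)"] by (auto simp: fresh_def)
      show "insert (p (a j)) (fresh p (a j)) \<inter> insert (p (b j)) (fresh p (b j)) = {}"
        by (rule fresh_disjoint[OF c ab(1-3)[OF j]])
      show "fresh p (a j) \<noteq> {}" by (rule fresh_nonempty[OF c ab(1,4)[OF j]])
      show "card (fresh p (a j)) \<le> 2" by (rule card_fresh_le[OF c ab(1,4)[OF j]])
      show "card (fresh p (b j)) \<le> 2" by (rule card_fresh_le[OF c ab(5,3)[OF j]])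
    qed simp_all
  qed simp
  also have "\<dots> = decay ^ m * weight ?n p"
  proof (induction m)
    case 0
    then show ?case by (simp add: weight_def)
  next
    case (Suc m)
    have "weight (2 * Suc m + 1) p = weight (2 * m + 1) p * (1 / (card (fresh p (a m)) + 1) * (1 / (card (fresh p (b m)) + 1)))"
      using weight_Suc[of "2 * m + 1" p] weight_Suc[of "2 * m + 2" p] by (simp add: a_def b_def)
    then show ?case using Suc by (simp only: prod.lessThan_Suc power_Suc mult_ac)
  qed
  finally show ?thesis .
qed

text \<open>A union bound together with \<open>sum_weight_le\<close>, which speaks of paths with at
  least two steps; for \<open>m = 0\<close> the bound is trivial.\<close>

lemma prob_some_chordless_path_le:
  "\<P>(\<omega> in M. \<exists>p\<in>chordless_paths v (2 * m + 1). \<forall>i\<le>2 * m + 1. p i \<in> peaks (\<lambda>v. X v \<omega>))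
    \<le> 16 * decay ^ m"
proof (cases m)
  case 0
  then show ?thesis by (auto intro: order_trans[OF prob_le_1])
next
  case (Suc l)
  let ?n = "2 * m + 1"
  let ?E = "\<lambda>p. {\<omega> \<in> space M. \<forall>i\<le>?n. p i \<in> peaks (\<lambda>v. X v \<omega>)}"
  have "{\<omega> \<in> space M. \<exists>p\<in>chordless_paths v ?n. \<forall>i\<le>?n. p i \<in> peaks (\<lambda>v. X v \<omega>)} = (\<Union>p\<in>chordless_paths v ?n. ?E p)"
    by auto
  also have "prob \<dots> \<le> (\<Sum>p\<in>chordless_paths v ?n. prob (?E p))"
    using predE[OF pred_path_peaks] by (intro finite_measure_subadditive_finite finite_chordless_paths) blast
  \<comment> \<open>The last factor of the weight is dropped, because \<open>sum_weight_le\<close>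
    weighs paths of \<open>n + 2\<close> steps by \<open>weight (n + 1)\<close>.\<close>
  also have "\<dots> \<le> (\<Sum>p\<in>chordless_paths v ?n. decay ^ m * weight (2 * m) p)"
  proof (rule sum_mono)
    fix p assume "p \<in> chordless_paths v ?n"
    then have "prob (?E p) \<le> decay ^ m * weight ?n p" by (rule prob_chordless_path_le)
    also have "\<dots> \<le> decay ^ m * weight (2 * m) p"
      using weight_Suc_le[of "2 * m" p] by (intro mult_left_mono) auto
    finally show "prob (?E p) \<le> decay ^ m * weight (2 * m) p" .
  qed
  also have "\<dots> = decay ^ m * (\<Sum>p\<in>chordless_paths v (2 * l + 1 + 2). weight (2 * l + 1 + 1) p)"
    by (simp add: Suc sum_distrib_left)
  also have "\<dots> \<le> decay ^ m * 16"
    by (intro mult_left_mono sum_weight_le) auto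
  finally show ?thesis by (simp only: mult.commute)
qed

text \<open>With at most \<open>k\<close> starting points for each \<open>m\<close>, the
  probabilities are dominated by a geometric series and Borel-Cantelli applies. The points may move
  with \<open>m\<close>, which serves both a fixed vertex and starting points ever further to the
  right.\<close>

lemma AE_no_chordless_path:
  assumes S: "\<And>m. finite (S m)" "\<And>m. card (S m) \<le> k"
  shows "AE \<omega> in M. \<forall>\<^sub>F m in sequentially. \<forall>v\<in>S m.
    \<not> (\<exists>p\<in>chordless_paths v (2 * m + 1). \<forall>i\<le>2 * m + 1. p i \<in> peaks (\<lambda>v. X v \<omega>))"
proof -
  define P where "P m v \<omega> \<longleftrightarrow> (\<exists>p\<in>chordless_paths v (2 * m + 1). \<forall>i\<le>2 * m + 1. p i \<in> peaks (\<lambda>v. X v \<omega>))"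
    for m v \<omega>
  let ?E = "\<lambda>m. {\<omega> \<in> space M. \<exists>v\<in>S m. P m v \<omega>}"
  have P: "Measurable.pred M (P m v)" for m v
    unfolding P_def by (rule pred_some_path_peaks)
  have E: "?E m \<in> events" for m
    by (rule predE[OF pred_intros_finite(4)[OF S(1) P]])
  have "prob (?E m) \<le> real k * (16 * decay ^ m)" for m
  proof -
    have "?E m = (\<Union>v\<in>S m. {\<omega> \<in> space M. P m v \<omega>})" by auto
    also have "prob \<dots> \<le> (\<Sum>v\<in>S m. prob {\<omega> \<in> space M. P m v \<omega>})"
      using predE[OF P] by (intro finite_measure_subadditive_finite S(1)) blast
    also have "\<dots> \<le> (\<Sum>v\<in>S m. 16 * decay ^ m)"
      unfolding P_def by (intro sum_mono prob_some_chordless_path_le)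
    also have "\<dots> = real (card (S m)) * (16 * decay ^ m)" by simp
    also have "\<dots> \<le> real k * (16 * decay ^ m)"
      using S(2) by (intro mult_right_mono) auto
    finally show ?thesis .
  qed
  then have bound: "norm (prob (?E m)) \<le> real k * (16 * decay ^ m)" for m by simp
  have "summable (\<lambda>m. real k * (16 * decay ^ m))"
    by (intro summable_mult summable_geometric) (simp add: decay_less_1)
  then have "summable (\<lambda>m. prob (?E m))"
    using bound by (rule summable_comparison_test'[where N = 0])
  then have ae: "AE \<omega> in M. \<forall>\<^sub>F m in sequentially. \<omega> \<in> space M - ?E m"
    by (intro borel_cantelli_AE1 E) (simp_all add: emeasure_eq_measure)
  have "AE \<omega> in M. \<forall>\<^sub>F m in sequentially. \<forall>v\<in>S m. \<not> P m v \<omega>"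
    using ae
  proof eventually_elim
    fix \<omega> assume "\<forall>\<^sub>F m in sequentially. \<omega> \<in> space M - ?E m"
    then show "\<forall>\<^sub>F m in sequentially. \<forall>v\<in>S m. \<not> P m v \<omega>"
      by (rule eventually_mono) auto
  qed
  then show ?thesis by (simp only: P_def)
qed

end

section \<open>From the probability estimates to almost every configuration of ages\<close>

theorem theorem1p4:
  fixes M :: "'a measure" and X :: "int \<times> int \<Rightarrow> 'a \<Rightarrow> real"
  assumes "prob_space M"
    and "prob_space.indep_vars M (\<lambda>_. borel) X UNIV"
    and "\<And>v. distr M borel (X v) = uniform_measure lborel {0..1}"
  shows "AE \<omega> in M. \<exists>!C. C \<in> induced_components grid2 (layers_upto grid2 (\<lambda>v. X v \<omega>) 4) \<and> infinite C"
proof -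
  interpret grid_ages M X
    using assms by (simp add: grid_ages_def iid_ages_def iid_ages_axioms_def)
  define P where "P m v \<omega> \<longleftrightarrow> (\<exists>p\<in>chordless_paths v (2 * m + 1). \<forall>i\<le>2 * m + 1. p i \<in> peaks (\<lambda>v. X v \<omega>))"
    for m v \<omega>
  have "AE \<omega> in M. \<forall>\<^sub>F m in sequentially. \<not> P m v \<omega>" for v
    using AE_no_chordless_path[of "\<lambda>_. {v}" 1] unfolding P_def by simp
  then have 1: "AE \<omega> in M. \<forall>v. \<forall>\<^sub>F m in sequentially. \<not> P m v \<omega>"
    by (simp add: AE_all_countable)
  \<comment> \<open>Path lengths grow by 2 with \<open>m\<close>, so each \<open>m\<close> takes two
    columns; together they cover all positive columns, in the two rows bounding the faces of the
    ray.\<close>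
  let ?S = "\<lambda>m. {2 * int m + 1, 2 * int m + 2} \<times> {0, 1 :: int}"
  have 2: "AE \<omega> in M. \<forall>\<^sub>F m in sequentially. \<forall>v\<in>?S m. \<not> P m v \<omega>"
    unfolding P_def by (rule AE_no_chordless_path[of _ 4]) auto
  from 1 2 show ?thesis
  proof eventually_elim
    fix \<omega>
    let ?D = "peaks (\<lambda>v. X v \<omega>)"
    assume 1: "\<forall>v. \<forall>\<^sub>F m in sequentially. \<not> P m v \<omega>"
      and 2: "\<forall>\<^sub>F m in sequentially. \<forall>v\<in>?S m. \<not> P m v \<omega>"
    obtain n where n: "\<And>m v. n \<le> m \<Longrightarrow> v \<in> ?S m \<Longrightarrow> \<not> P m v \<omega>"
      using 2 unfolding eventually_sequentially by blast
    show "\<exists>!C. C \<in> induced_components grid2 (layers_upto grid2 (\<lambda>v. X v \<omega>) 4) \<and> infinite C"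
      unfolding layers_upto_grid2
    proof (rule unique_infinite_component_if_finite_clusters)
      show "finite ((diag_links ?D)\<^sup>* `` {v})" for v
      proof -
        obtain m where m: "\<not> P m v \<omega>"
          using 1 unfolding eventually_sequentially by blast
        let ?k = "int (2 * m + 1)"
        have "(diag_links ?D)\<^sup>* `` {v} \<subseteq> {fst v - ?k..fst v + ?k} \<times> {snd v - ?k..snd v + ?k}"
          using cluster_within[OF m[unfolded P_def]] by (fastforce simp: abs_less_iff)
        then show ?thesis by (rule finite_subset) simp
      qed
      show "0 < fst w" if "2 * int n < c" "y \<in> {0, 1}" "((c, y), w) \<in> (diag_links ?D)\<^sup>*" for c y w
      proof -
        \<comment> \<open>The index whose two columns include \<open>c\<close>. A cluster that moves
          less than \<open>2 * m + 1\<close> from a column at least that far right does not reach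
          the axis.\<close>
        define m where "m = nat ((c - 1) div 2)"
        have m: "n \<le> m" "2 * int m + 1 \<le> c" "c \<le> 2 * int m + 2"
          using that(1) by (auto simp: m_def)
        then have "c = 2 * int m + 1 \<or> c = 2 * int m + 2" by linarith
        then have "(c, y) \<in> ?S m" using that(2) by auto
        then have "\<not> P m (c, y) \<omega>" using n m by blast
        from cluster_within[OF this[unfolded P_def] _ that(3)] have "\<bar>fst w - c\<bar> < 2 * int m + 1" by simp
        then show ?thesis using m by linarith
      qed
    qed (rule peaks_indep)
  qed
qed
end
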